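(* Let $(\mathcal C,\mathcal{FL},\mathcal{CL})$ be a triple satisfying conditions [S1] and [S4] recalled in the context. Let $(F,\mathcal M)\in\mathbf{LogCFG}/\mathcal C$, with $F:\mathcal X\to\mathcal C$ and $\mathcal M:\mathcal X\to\mathcal{CL}^*$. If $F$ is a stack over $\mathcal C_\tau$, then $\Phi_{CFG}\mathcal M$ is a stack over $\mathcal{FL}_\tau$. If $(F,\mathcal M)\in\mathbf{FLogCFG}/\mathcal C$, then the converse is true, i.e. $F$ is a stack over $\mathcal C_\tau$ if and only if $\Phi_{CFG}\mathcal M$ is a stack over $\mathcal{FL}_\tau$.
   Context: [S1]: $\mathcal{CL}\to\mathcal C$, written $(f:x\to y)\mapsto(\underline f:\underline x\to\underline y)$, is a fibered category; $\mathcal{FL}\to\mathcal C$ is a full sub-fibration of it (full subcategory, fibered over $\mathcal C$, compatibly with cartesian arrows); $\mathcal{CL}^*\to\mathcal C$ and $\mathcal{FL}^*\to\mathcal C$ are the associated groupoid fibrations (same objects, only cartesian arrows). [S4]: $\mathcal C$ has a Grothendieck topology $\tau$, giving the site $\mathcal C_\tau$; $\mathcal{CL}_\tau$ (resp. $\mathcal{FL}_\tau$) is the site with the pullback topology: a covering is a family $\{c_i\to c\}$ of cartesian arrows such that $\{\underline{c_i}\to\underline c\}$ is a covering in $\mathcal C_\tau$. $\mathcal{FL}\to\mathcal C$ is a general stack (a fibered category, not necessarily in groupoids, with all descent data effective), and for every $x\in\mathcal{CL}$ the presheaf $u\mapsto\mathcal{CL}(u,x)$, $u\in\mathcal{FL}$,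 is a sheaf on $\mathcal{FL}_\tau$. "Stack" means a category fibered in groupoids with all descent data (of objects and morphisms) effective. $\mathbf{LogCFG}/\mathcal C$: objects are pairs $(F,\mathcal M)$ with $F:\mathcal X\to\mathcal C$ a category fibered in groupoids and $\mathcal M:\mathcal X\to\mathcal{CL}^*$ a functor whose composite with $\mathcal{CL}^*\to\mathcal C$ is $F$. $\mathbf{FLogCFG}/\mathcal C$ consists of those pairs with $\mathcal M$ factoring through $\mathcal{FL}^*$. $\Phi_{CFG}\mathcal M$ is the category over $\mathcal{FL}$ with objects pairs $(x,f:x'\to\mathcal Mx)$, where $x\in\mathcal X$, $x'\in\mathcal{FL}$ and $f$ is a morphism of $\mathcal{CL}$ with $\underline f=\mathrm{id}$; a morphism $(x,f:x'\to\mathcal Mx)\to(y,g:y'\to\mathcal My)$ is a pair $(a,b)$ with $a\in\mathcal X(x,y)$, $b\in\mathcal{FL}(x',y')$ and $g\,b=\mathcal M(a)\,f$; the projection to $\mathcal{FL}$ is $(x,f)\mapsto x'$, $(a,b)\mapsto b$. It is a category fibered in groupoids over $\mathcal{FL}$. *)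

theory Defs
  imports Main
begin

section \<open>Categories and functors\<close>

record ('o, 'a) category =
  Obj :: "'o set"
  Arr :: "'a set"
  Dom :: "'a \<Rightarrow> 'o"
  Cod :: "'a \<Rightarrow> 'o"
  Id :: "'o \<Rightarrow> 'a"
  Comp :: "'a \<Rightarrow> 'a \<Rightarrow> 'a" (infixr "\<odot>\<index>" 70)

definition Hom :: "('o, 'a) category \<Rightarrow> 'o \<Rightarrow> 'o \<Rightarrow> 'a set" where
  "Hom C x y = {f \<in> Arr C. Dom C f = x \<and> Cod C f = y}"

locale category =
  fixes C :: "('o, 'a) category" (structure)
  assumes Dom_in_Obj: "f \<in> Arr C \<Longrightarrow> Dom C f \<in> Obj C"
    and Cod_in_Obj: "f \<in> Arr C \<Longrightarrow> Cod C f \<in> Obj C"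
    and Id_in_Hom: "x \<in> Obj C \<Longrightarrow> Id C x \<in> Hom C x x"
    and Comp_in_Hom: "\<lbrakk>f \<in> Hom C x y; g \<in> Hom C y z\<rbrakk> \<Longrightarrow> g \<odot> f \<in> Hom C x z"
    and Comp_Id: "f \<in> Hom C x y \<Longrightarrow> f \<odot> Id C x = f"
    and Id_Comp: "f \<in> Hom C x y \<Longrightarrow> Id C y \<odot> f = f"
    and Comp_assoc: "\<lbrakk>f \<in> Hom C w x; g \<in> Hom C x y; h \<in> Hom C y z\<rbrakk>
          \<Longrightarrow> (h \<odot> g) \<odot> f = h \<odot> (g \<odot> f)"

definition iso :: "('o, 'a) category \<Rightarrow> 'a \<Rightarrow> bool" where
  "iso C f \<longleftrightarrow> f \<in> Arr C \<and>
     (\<exists>g \<in> Hom C (Cod C f) (Dom C f).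
        g \<odot>\<^bsub>C\<^esub> f = Id C (Dom C f) \<and> f \<odot>\<^bsub>C\<^esub> g = Id C (Cod C f))"

definition groupoid :: "('o, 'a) category \<Rightarrow> bool" where
  "groupoid C \<longleftrightarrow> category C \<and> (\<forall>f \<in> Arr C. iso C f)"

definition full_subcategory :: "('o, 'a) category \<Rightarrow> ('o, 'a) category \<Rightarrow> bool" where
  "full_subcategory D C \<longleftrightarrow> Obj D \<subseteq> Obj C \<and>
     D = C\<lparr>Obj := Obj D, Arr := {f \<in> Arr C. Dom C f \<in> Obj D \<and> Cod C f \<in> Obj D}\<rparr>"

text \<open>\<open>p\<close> and \<open>q\<close> are the projections of a fibre product of \<open>f\<close> and \<open>g\<close>, with \<open>f p = g q\<close>.\<close>

definition is_pullback :: "('o, 'a) category \<Rightarrow> 'a \<Rightarrow> 'a \<Rightarrow> 'a \<Rightarrow> 'a \<Rightarrow> bool" where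
  "is_pullback C f g p q \<longleftrightarrow>
     f \<in> Arr C \<and> g \<in> Arr C \<and> Cod C f = Cod C g \<and>
     p \<in> Hom C (Dom C p) (Dom C f) \<and> q \<in> Hom C (Dom C p) (Dom C g) \<and>
     f \<odot>\<^bsub>C\<^esub> p = g \<odot>\<^bsub>C\<^esub> q \<and>
     (\<forall>w. \<forall>r \<in> Hom C w (Dom C f). \<forall>s \<in> Hom C w (Dom C g).
        f \<odot>\<^bsub>C\<^esub> r = g \<odot>\<^bsub>C\<^esub> s \<longrightarrow>
        (\<exists>!t. t \<in> Hom C w (Dom C p) \<and> p \<odot>\<^bsub>C\<^esub> t = r \<and> q \<odot>\<^bsub>C\<^esub> t = s))"

record ('o, 'a, 'p, 'b) functor_maps =
  omap :: "'o \<Rightarrow> 'p"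
  amap :: "'a \<Rightarrow> 'b"

locale cat_functor = A: category A + B: category B
  for A :: "('o, 'a) category" and B :: "('p, 'b) category" +
  fixes F :: "('o, 'a, 'p, 'b) functor_maps"
  assumes omap_in_Obj: "x \<in> Obj A \<Longrightarrow> omap F x \<in> Obj B"
    and amap_in_Hom: "f \<in> Hom A x y \<Longrightarrow> amap F f \<in> Hom B (omap F x) (omap F y)"
    and amap_Id: "x \<in> Obj A \<Longrightarrow> amap F (Id A x) = Id B (omap F x)"
    and amap_Comp: "\<lbrakk>f \<in> Hom A x y; g \<in> Hom A y z\<rbrakk>
          \<Longrightarrow> amap F (g \<odot>\<^bsub>A\<^esub> f) = amap F g \<odot>\<^bsub>B\<^esub> amap F f"


section \<open>Fibered categories\<close>

definition cartesian ::
  "('e, 'f) category \<Rightarrow> ('o, 'a) category \<Rightarrow> ('e, 'f, 'o, 'a) functor_maps \<Rightarrow> 'f \<Rightarrow> bool" where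
  "cartesian E B P f \<longleftrightarrow> f \<in> Arr E \<and>
     (\<forall>g \<in> Arr E. \<forall>h \<in> Hom B (omap P (Dom E g)) (omap P (Dom E f)).
        Cod E g = Cod E f \<and> amap P f \<odot>\<^bsub>B\<^esub> h = amap P g \<longrightarrow>
        (\<exists>!k. k \<in> Hom E (Dom E g) (Dom E f) \<and> amap P k = h \<and> f \<odot>\<^bsub>E\<^esub> k = g))"

definition fibered ::
  "('e, 'f) category \<Rightarrow> ('o, 'a) category \<Rightarrow> ('e, 'f, 'o, 'a) functor_maps \<Rightarrow> bool" where
  "fibered E B P \<longleftrightarrow> cat_functor E B P \<and>
     (\<forall>y \<in> Obj E. \<forall>f \<in> Arr B. Cod B f = omap P y \<longrightarrow>
        (\<exists>g. cartesian E B P g \<and> Cod E g = y \<and> amap P g = f))"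

definition fiber ::
  "('e, 'f) category \<Rightarrow> ('o, 'a) category \<Rightarrow> ('e, 'f, 'o, 'a) functor_maps \<Rightarrow> 'o
    \<Rightarrow> ('e, 'f) category" where
  "fiber E B P U =
     E\<lparr>Obj := {x \<in> Obj E. omap P x = U}, Arr := {f \<in> Arr E. amap P f = Id B U}\<rparr>"

definition fibered_in_groupoids ::
  "('e, 'f) category \<Rightarrow> ('o, 'a) category \<Rightarrow> ('e, 'f, 'o, 'a) functor_maps \<Rightarrow> bool" where
  "fibered_in_groupoids E B P \<longleftrightarrow>
     fibered E B P \<and> (\<forall>U \<in> Obj B. groupoid (fiber E B P U))"

text \<open>The associated groupoid fibration: all objects, but only the cartesian arrows.\<close>

definition cart_part ::
  "('e, 'f) category \<Rightarrow> ('o, 'a) category \<Rightarrow> ('e, 'f, 'o, 'a) functor_maps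
    \<Rightarrow> ('e, 'f) category" where
  "cart_part E B P = E\<lparr>Arr := {f. cartesian E B P f}\<rparr>"

definition full_subfibration ::
  "('e, 'f) category \<Rightarrow> ('e, 'f) category \<Rightarrow> ('o, 'a) category
    \<Rightarrow> ('e, 'f, 'o, 'a) functor_maps \<Rightarrow> bool" where
  "full_subfibration D E B P \<longleftrightarrow>
     full_subcategory D E \<and> fibered D B P \<and> (\<forall>f. cartesian D B P f \<longrightarrow> cartesian E B P f)"


section \<open>Grothendieck topologies and sheaves\<close>

text \<open>
  A topology is given by its covering families: \<open>cov U I \<sigma>\<close> says that \<open>(\<sigma> i)\<close>, \<open>i \<in> I\<close>, is a
  covering of \<open>U\<close>. The index sets are subsets of one fixed type, so the family indexed by the
  disjoint union \<open>Sigma I J\<close> in the composition axiom is replaced by its reindexings along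
  bijections \<open>K \<rightarrow> Sigma I J\<close>.
\<close>

type_synonym ('i, 'o, 'a) coverings = "'o \<Rightarrow> 'i set \<Rightarrow> ('i \<Rightarrow> 'a) \<Rightarrow> bool"

locale grothendieck_topology = category C
  for C :: "('o, 'a) category" (structure) +
  fixes cov :: "('i, 'o, 'a) coverings"
  assumes cov_Obj: "cov U I \<sigma> \<Longrightarrow> U \<in> Obj C"
    and cov_Arr: "\<lbrakk>cov U I \<sigma>; i \<in> I\<rbrakk> \<Longrightarrow> \<sigma> i \<in> Arr C \<and> Cod C (\<sigma> i) = U"
    and cov_iso: "iso C f \<Longrightarrow> cov (Cod C f) {i} (\<lambda>_. f)"
    and pullback_exists: "\<lbrakk>cov U I \<sigma>; g \<in> Hom C V U; i \<in> I\<rbrakk>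
          \<Longrightarrow> \<exists>p q. is_pullback C g (\<sigma> i) p q"
    and cov_pullback: "\<lbrakk>cov U I \<sigma>; g \<in> Hom C V U; \<And>i. i \<in> I \<Longrightarrow> is_pullback C g (\<sigma> i) (p i) (q i)\<rbrakk>
          \<Longrightarrow> cov V I p"
    and cov_compose: "\<lbrakk>cov U I \<sigma>; \<And>i. i \<in> I \<Longrightarrow> cov (Dom C (\<sigma> i)) (J i) (\<tau> i);
            bij_betw e K (Sigma I J)\<rbrakk>
          \<Longrightarrow> cov U K (\<lambda>k. \<sigma> (fst (e k)) \<odot> \<tau> (fst (e k)) (snd (e k)))"

definition pullback_topology ::
  "('e, 'f) category \<Rightarrow> ('o, 'a) category \<Rightarrow> ('e, 'f, 'o, 'a) functor_maps
    \<Rightarrow> ('i, 'o, 'a) coverings \<Rightarrow> ('i, 'e, 'f) coverings" where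
  "pullback_topology E B P cov x I \<sigma> \<longleftrightarrow> x \<in> Obj E \<and>
     (\<forall>i \<in> I. cartesian E B P (\<sigma> i) \<and> Cod E (\<sigma> i) = x) \<and>
     cov (omap P x) I (\<lambda>i. amap P (\<sigma> i))"

definition presheaf ::
  "('o, 'a) category \<Rightarrow> ('o \<Rightarrow> 's set) \<Rightarrow> ('a \<Rightarrow> 's \<Rightarrow> 's) \<Rightarrow> bool" where
  "presheaf B S res \<longleftrightarrow>
     (\<forall>f \<in> Arr B. \<forall>s \<in> S (Cod B f). res f s \<in> S (Dom B f)) \<and>
     (\<forall>U \<in> Obj B. \<forall>s \<in> S U. res (Id B U) s = s) \<and>
     (\<forall>f \<in> Arr B. \<forall>g \<in> Arr B. Cod B f = Dom B g \<longrightarrow>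
        (\<forall>s \<in> S (Cod B g). res (g \<odot>\<^bsub>B\<^esub> f) s = res f (res g s)))"

definition sheaf ::
  "('o, 'a) category \<Rightarrow> ('i, 'o, 'a) coverings \<Rightarrow> ('o \<Rightarrow> 's set) \<Rightarrow> ('a \<Rightarrow> 's \<Rightarrow> 's) \<Rightarrow> bool" where
  "sheaf B cov S res \<longleftrightarrow> presheaf B S res \<and>
     (\<forall>U I \<sigma> s. cov U I \<sigma> \<and> (\<forall>i \<in> I. s i \<in> S (Dom B (\<sigma> i))) \<and>
        (\<forall>i \<in> I. \<forall>j \<in> I. \<forall>p q. is_pullback B (\<sigma> i) (\<sigma> j) p q \<longrightarrow> res p (s i) = res q (s j)) \<longrightarrow>
        (\<exists>!t. t \<in> S U \<and> (\<forall>i \<in> I. res (\<sigma> i) t = s i)))"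


section \<open>Descent data and stacks\<close>

text \<open>
  Descent data without a choice of cleavage. For a covering \<open>\<sigma> i : U\<^sub>i \<rightarrow> U\<close>, a datum consists of
  objects \<open>\<xi>\<^sub>i = local_obj D i\<close> over \<open>U\<^sub>i\<close> and, for all \<open>i\<close>, \<open>j\<close>, of cartesian arrows
  \<open>res1 D i j : \<xi>\<^sub>i\<^sub>j \<rightarrow> \<xi>\<^sub>i\<close> and \<open>res2 D i j : \<xi>\<^sub>i\<^sub>j \<rightarrow> \<xi>\<^sub>j\<close> over the projections of a fibre product
  \<open>U\<^sub>i\<^sub>j\<close>. They exhibit \<open>\<xi>\<^sub>i\<^sub>j\<close> as a pullback both of \<open>\<xi>\<^sub>i\<close> and of \<open>\<xi>\<^sub>j\<close>, which amounts to
  a transition isomorphism between any two pullbacks of \<open>\<xi>\<^sub>j\<close> and of \<open>\<xi>\<^sub>i\<close> to \<open>U\<^sub>i\<^sub>j\<close>. The cocycle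
  condition is the existence of \<open>\<xi>\<^sub>i\<^sub>j\<^sub>k\<close> over \<open>U\<^sub>i\<^sub>j\<^sub>k\<close>, the fibre product of \<open>U\<^sub>i\<^sub>j\<close> and \<open>U\<^sub>j\<^sub>k\<close>
  over \<open>U\<^sub>j\<close>, with cartesian arrows \<open>c12\<close>, \<open>c23\<close>, \<open>c13\<close> to \<open>\<xi>\<^sub>i\<^sub>j\<close>, \<open>\<xi>\<^sub>j\<^sub>k\<close>, \<open>\<xi>\<^sub>i\<^sub>k\<close> that are
  compatible with the arrows to \<open>\<xi>\<^sub>i\<close>, \<open>\<xi>\<^sub>j\<close>, \<open>\<xi>\<^sub>k\<close>.
\<close>

record ('i, 'e, 'f) descent_data =
  local_obj :: "'i \<Rightarrow> 'e"
  res1 :: "'i \<Rightarrow> 'i \<Rightarrow> 'f"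
  res2 :: "'i \<Rightarrow> 'i \<Rightarrow> 'f"

definition overlap_obj ::
  "('e, 'f) category \<Rightarrow> ('i, 'e, 'f) descent_data \<Rightarrow> 'i \<Rightarrow> 'i \<Rightarrow> 'e" where
  "overlap_obj E D i j = Dom E (res1 D i j)"

definition cocycle ::
  "('e, 'f) category \<Rightarrow> ('o, 'a) category \<Rightarrow> ('e, 'f, 'o, 'a) functor_maps
    \<Rightarrow> ('i, 'e, 'f) descent_data \<Rightarrow> 'i \<Rightarrow> 'i \<Rightarrow> 'i \<Rightarrow> bool" where
  "cocycle E B P D i j k \<longleftrightarrow>
     (\<exists>z c12 c23 c13.
        cartesian E B P c12 \<and> c12 \<in> Hom E z (overlap_obj E D i j) \<and>
        cartesian E B P c23 \<and> c23 \<in> Hom E z (overlap_obj E D j k) \<and>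
        cartesian E B P c13 \<and> c13 \<in> Hom E z (overlap_obj E D i k) \<and>
        is_pullback B (amap P (res2 D i j)) (amap P (res1 D j k)) (amap P c12) (amap P c23) \<and>
        res1 D i j \<odot>\<^bsub>E\<^esub> c12 = res1 D i k \<odot>\<^bsub>E\<^esub> c13 \<and>
        res2 D i j \<odot>\<^bsub>E\<^esub> c12 = res1 D j k \<odot>\<^bsub>E\<^esub> c23 \<and>
        res2 D j k \<odot>\<^bsub>E\<^esub> c23 = res2 D i k \<odot>\<^bsub>E\<^esub> c13)"

definition descent_datum ::
  "('e, 'f) category \<Rightarrow> ('o, 'a) category \<Rightarrow> ('e, 'f, 'o, 'a) functor_maps
    \<Rightarrow> 'i set \<Rightarrow> ('i \<Rightarrow> 'a) \<Rightarrow> ('i, 'e, 'f) descent_data \<Rightarrow> bool" where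
  "descent_datum E B P I \<sigma> D \<longleftrightarrow>
     (\<forall>i \<in> I. local_obj D i \<in> Obj E \<and> omap P (local_obj D i) = Dom B (\<sigma> i)) \<and>
     (\<forall>i \<in> I. \<forall>j \<in> I.
        cartesian E B P (res1 D i j) \<and> res1 D i j \<in> Hom E (overlap_obj E D i j) (local_obj D i) \<and>
        cartesian E B P (res2 D i j) \<and> res2 D i j \<in> Hom E (overlap_obj E D i j) (local_obj D j) \<and>
        is_pullback B (\<sigma> i) (\<sigma> j) (amap P (res1 D i j)) (amap P (res2 D i j))) \<and>
     (\<forall>i \<in> I. \<forall>j \<in> I. \<forall>k \<in> I. cocycle E B P D i j k)"

text \<open>Morphisms are only considered between data over the same fibre products \<open>U\<^sub>i\<^sub>j\<close>.\<close>

definition same_overlaps ::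
  "('e, 'f, 'o, 'a) functor_maps \<Rightarrow> 'i set
    \<Rightarrow> ('i, 'e, 'f) descent_data \<Rightarrow> ('i, 'e, 'f) descent_data \<Rightarrow> bool" where
  "same_overlaps P I D D' \<longleftrightarrow>
     (\<forall>i \<in> I. \<forall>j \<in> I. amap P (res1 D i j) = amap P (res1 D' i j) \<and>
                    amap P (res2 D i j) = amap P (res2 D' i j))"

definition descent_morphism ::
  "('e, 'f) category \<Rightarrow> ('o, 'a) category \<Rightarrow> ('e, 'f, 'o, 'a) functor_maps
    \<Rightarrow> 'i set \<Rightarrow> ('i \<Rightarrow> 'a) \<Rightarrow> ('i, 'e, 'f) descent_data \<Rightarrow> ('i, 'e, 'f) descent_data
    \<Rightarrow> ('i \<Rightarrow> 'f) \<Rightarrow> bool" where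
  "descent_morphism E B P I \<sigma> D D' \<alpha> \<longleftrightarrow>
     (\<forall>i \<in> I. \<alpha> i \<in> Hom E (local_obj D i) (local_obj D' i) \<and> amap P (\<alpha> i) = Id B (Dom B (\<sigma> i))) \<and>
     (\<forall>i \<in> I. \<forall>j \<in> I. \<exists>\<beta> \<in> Hom E (overlap_obj E D i j) (overlap_obj E D' i j).
        amap P \<beta> = Id B (omap P (overlap_obj E D i j)) \<and>
        res1 D' i j \<odot>\<^bsub>E\<^esub> \<beta> = \<alpha> i \<odot>\<^bsub>E\<^esub> res1 D i j \<and>
        res2 D' i j \<odot>\<^bsub>E\<^esub> \<beta> = \<alpha> j \<odot>\<^bsub>E\<^esub> res2 D i j)"

text \<open>\<open>D\<close> is the datum of restrictions of the object \<open>x\<close> over \<open>U\<close>, via \<open>\<rho> i : \<xi>\<^sub>i \<rightarrow> x\<close>.\<close>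

definition restricts_to ::
  "('e, 'f) category \<Rightarrow> ('o, 'a) category \<Rightarrow> ('e, 'f, 'o, 'a) functor_maps
    \<Rightarrow> 'o \<Rightarrow> 'i set \<Rightarrow> ('i \<Rightarrow> 'a) \<Rightarrow> 'e \<Rightarrow> ('i \<Rightarrow> 'f) \<Rightarrow> ('i, 'e, 'f) descent_data \<Rightarrow> bool" where
  "restricts_to E B P U I \<sigma> x \<rho> D \<longleftrightarrow> x \<in> Obj E \<and> omap P x = U \<and>
     (\<forall>i \<in> I. cartesian E B P (\<rho> i) \<and> \<rho> i \<in> Hom E (local_obj D i) x \<and> amap P (\<rho> i) = \<sigma> i) \<and>
     (\<forall>i \<in> I. \<forall>j \<in> I. \<rho> i \<odot>\<^bsub>E\<^esub> res1 D i j = \<rho> j \<odot>\<^bsub>E\<^esub> res2 D i j)"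

definition descent_of_objects ::
  "('e, 'f) category \<Rightarrow> ('o, 'a) category \<Rightarrow> ('e, 'f, 'o, 'a) functor_maps
    \<Rightarrow> 'o \<Rightarrow> 'i set \<Rightarrow> ('i \<Rightarrow> 'a) \<Rightarrow> bool" where
  "descent_of_objects E B P U I \<sigma> \<longleftrightarrow>
     (\<forall>D. descent_datum E B P I \<sigma> D \<longrightarrow> (\<exists>x \<rho>. restricts_to E B P U I \<sigma> x \<rho> D))"

definition descent_of_morphisms ::
  "('e, 'f) category \<Rightarrow> ('o, 'a) category \<Rightarrow> ('e, 'f, 'o, 'a) functor_maps
    \<Rightarrow> 'o \<Rightarrow> 'i set \<Rightarrow> ('i \<Rightarrow> 'a) \<Rightarrow> bool" where
  "descent_of_morphisms E B P U I \<sigma> \<longleftrightarrow>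
     (\<forall>D D' x \<rho> x' \<rho>' \<alpha>.
        descent_datum E B P I \<sigma> D \<and> restricts_to E B P U I \<sigma> x \<rho> D \<and>
        descent_datum E B P I \<sigma> D' \<and> restricts_to E B P U I \<sigma> x' \<rho>' D' \<and>
        same_overlaps P I D D' \<and> descent_morphism E B P I \<sigma> D D' \<alpha> \<longrightarrow>
        (\<exists>!h. h \<in> Hom E x x' \<and> amap P h = Id B U \<and>
              (\<forall>i \<in> I. h \<odot>\<^bsub>E\<^esub> \<rho> i = \<rho>' i \<odot>\<^bsub>E\<^esub> \<alpha> i)))"

definition general_stack ::
  "('e, 'f) category \<Rightarrow> ('o, 'a) category \<Rightarrow> ('i, 'o, 'a) coverings
    \<Rightarrow> ('e, 'f, 'o, 'a) functor_maps \<Rightarrow> bool" where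
  "general_stack E B cov P \<longleftrightarrow> fibered E B P \<and>
     (\<forall>U I \<sigma>. cov U I \<sigma> \<longrightarrow> descent_of_objects E B P U I \<sigma> \<and> descent_of_morphisms E B P U I \<sigma>)"

definition stack ::
  "('e, 'f) category \<Rightarrow> ('o, 'a) category \<Rightarrow> ('i, 'o, 'a) coverings
    \<Rightarrow> ('e, 'f, 'o, 'a) functor_maps \<Rightarrow> bool" where
  "stack E B cov P \<longleftrightarrow> fibered_in_groupoids E B P \<and> general_stack E B cov P"


section \<open>Log structures\<close>

definition S1 ::
  "('o, 'a) category \<Rightarrow> ('e, 'f) category \<Rightarrow> ('e, 'f) category
    \<Rightarrow> ('e, 'f, 'o, 'a) functor_maps \<Rightarrow> bool" where
  "S1 C FL CL P \<longleftrightarrow> fibered CL C P \<and> full_subfibration FL CL C P"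

definition S4 ::
  "('o, 'a) category \<Rightarrow> ('i, 'o, 'a) coverings \<Rightarrow> ('e, 'f) category \<Rightarrow> ('e, 'f) category
    \<Rightarrow> ('e, 'f, 'o, 'a) functor_maps \<Rightarrow> bool" where
  "S4 C cov FL CL P \<longleftrightarrow>
     grothendieck_topology C cov \<and> general_stack FL C cov P \<and>
     (\<forall>x \<in> Obj CL. sheaf FL (pullback_topology FL C P cov)
        (\<lambda>u. Hom CL u x) (\<lambda>f s. s \<odot>\<^bsub>CL\<^esub> f))"

definition LogCFG ::
  "('o, 'a) category \<Rightarrow> ('e, 'f) category \<Rightarrow> ('e, 'f, 'o, 'a) functor_maps
    \<Rightarrow> ('x, 'y) category \<Rightarrow> ('x, 'y, 'o, 'a) functor_maps \<Rightarrow> ('x, 'y, 'e, 'f) functor_maps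
    \<Rightarrow> bool" where
  "LogCFG C CL P X F M \<longleftrightarrow>
     fibered_in_groupoids X C F \<and> cat_functor X (cart_part CL C P) M \<and>
     (\<forall>x \<in> Obj X. omap P (omap M x) = omap F x) \<and>
     (\<forall>a \<in> Arr X. amap P (amap M a) = amap F a)"

definition FLogCFG ::
  "('o, 'a) category \<Rightarrow> ('e, 'f) category \<Rightarrow> ('e, 'f) category \<Rightarrow> ('e, 'f, 'o, 'a) functor_maps
    \<Rightarrow> ('x, 'y) category \<Rightarrow> ('x, 'y, 'o, 'a) functor_maps \<Rightarrow> ('x, 'y, 'e, 'f) functor_maps
    \<Rightarrow> bool" where
  "FLogCFG C FL CL P X F M \<longleftrightarrow>
     LogCFG C CL P X F M \<and> cat_functor X (cart_part FL C P) M"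

text \<open>
  An object \<open>(x, f : x' \<rightarrow> M x)\<close> is the pair \<open>(x, f)\<close>, with \<open>x'\<close> recovered as the domain of \<open>f\<close>.
  As \<open>(a, b)\<close> does not determine \<open>f\<close> and \<open>g\<close>, an arrow is a triple: source, target, \<open>(a, b)\<close>.
\<close>

type_synonym ('x, 'f) Phi_obj = "'x \<times> 'f"
type_synonym ('x, 'y, 'f) Phi_arr = "('x, 'f) Phi_obj \<times> ('x, 'f) Phi_obj \<times> 'y \<times> 'f"

definition Phi_Obj ::
  "('o, 'a) category \<Rightarrow> ('e, 'f) category \<Rightarrow> ('e, 'f) category \<Rightarrow> ('e, 'f, 'o, 'a) functor_maps
    \<Rightarrow> ('x, 'y) category \<Rightarrow> ('x, 'y, 'e, 'f) functor_maps \<Rightarrow> ('x, 'f) Phi_obj set" where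
  "Phi_Obj C FL CL P X M =
     {(x, f). x \<in> Obj X \<and> Dom CL f \<in> Obj FL \<and> f \<in> Hom CL (Dom CL f) (omap M x) \<and>
              amap P f = Id C (omap P (omap M x))}"

definition Phi ::
  "('o, 'a) category \<Rightarrow> ('e, 'f) category \<Rightarrow> ('e, 'f) category \<Rightarrow> ('e, 'f, 'o, 'a) functor_maps
    \<Rightarrow> ('x, 'y) category \<Rightarrow> ('x, 'y, 'e, 'f) functor_maps
    \<Rightarrow> (('x, 'f) Phi_obj, ('x, 'y, 'f) Phi_arr) category" where
  "Phi C FL CL P X M =
     \<lparr>Obj = Phi_Obj C FL CL P X M,
      Arr = {((x, f), (y, g), (a, b)).
               (x, f) \<in> Phi_Obj C FL CL P X M \<and> (y, g) \<in> Phi_Obj C FL CL P X M \<and>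
               a \<in> Hom X x y \<and> b \<in> Hom FL (Dom CL f) (Dom CL g) \<and>
               g \<odot>\<^bsub>CL\<^esub> b = amap M a \<odot>\<^bsub>CL\<^esub> f},
      Dom = (\<lambda>(s, t, ab). s),
      Cod = (\<lambda>(s, t, ab). t),
      Id = (\<lambda>(x, f). ((x, f), (x, f), (Id X x, Id FL (Dom CL f)))),
      Comp = (\<lambda>(s', t', (a', b')) (s, t, (a, b)). (s, t', (a' \<odot>\<^bsub>X\<^esub> a, b' \<odot>\<^bsub>FL\<^esub> b)))\<rparr>"

definition Phi_proj ::
  "('e, 'f) category \<Rightarrow> (('x, 'f) Phi_obj, ('x, 'y, 'f) Phi_arr, 'e, 'f) functor_maps" where
  "Phi_proj CL = \<lparr>omap = (\<lambda>(x, f). Dom CL f), amap = (\<lambda>(s, t, (a, b)). b)\<rparr>"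

end

theory Submission
  imports Defs
begin

text \<open>
  A descent datum in \<open>\<Phi>\<close> over a covering \<open>u\<^sub>i \<rightarrow> u\<close> of \<open>FL\<close> is a descent datum in \<open>X\<close> over the
  image of the covering in \<open>C\<close>, together with compatible arrows \<open>u\<^sub>i \<rightarrow> M x\<^sub>i\<close> over identities. If
  \<open>X\<close> is a stack, the first part descends to some \<open>x\<close>. Since \<open>CL(-, M x)\<close> is a sheaf, the second
  part glues to an arrow \<open>t : u \<rightarrow> M x\<close>, and the same sheaf condition makes an arrow obtained by
  descent in \<open>X\<close> compatible with the arrows into the image of \<open>M\<close> (\<open>Phi_descent_of_objects\<close>,
  \<open>Phi_descent_of_arrows\<close>). The delicate point is that \<open>t\<close> lies over the identity of the base,
  which is a statement about \<open>C\<close>. It follows from \<open>endomorphism_trivial\<close>: an endomorphism of the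
  base of \<open>u\<close> that fixes a covering is the identity, because it can be lifted to \<open>FL\<close>, where one
  can use that \<open>FL\<close> is a stack and that \<open>CL(-, u)\<close> is a sheaf.

  Conversely, suppose that \<open>M\<close> takes values in \<open>FL\<close>. Then \<open>x \<mapsto> (x, id : M x \<rightarrow> M x)\<close> embeds \<open>X\<close>
  into \<open>\<Phi>\<close>. For a datum in \<open>X\<close>, one first descends its image under \<open>M\<close> in the stack \<open>FL\<close>. This
  produces an object \<open>y\<close> of \<open>FL\<close> with a covering \<open>M x\<^sub>i \<rightarrow> y\<close>, over which the objects \<open>(x\<^sub>i, id)\<close>
  form a datum in \<open>\<Phi>\<close>, and descent in \<open>\<Phi>\<close> gives the object or arrow sought
  (\<open>X_descent_of_objects\<close>, \<open>X_descent_of_arrows\<close>).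

  Fibre products have to be carried between \<open>FL\<close> and \<open>C\<close> in both directions. A commutative
  square with two parallel cartesian sides over a fibre product is a fibre product (\<open>cartesian_pullback\<close>),
  and a fibre product along a cartesian arrow maps to a fibre product whenever the base has one
  (\<open>pullback_image\<close>), which it does for coverings.
\<close>

section \<open>Fibre products\<close>

lemma Hom_iff: "f \<in> Hom C x y \<longleftrightarrow> f \<in> Arr C \<and> Dom C f = x \<and> Cod C f = y"
  by (simp add: Hom_def)

context category
begin

lemma Arr_Hom: "f \<in> Arr C \<Longrightarrow> f \<in> Hom C (Dom C f) (Cod C f)"
  by (simp add: Hom_def)

lemma Hom_Obj: "f \<in> Hom C x y \<Longrightarrow> x \<in> Obj C \<and> y \<in> Obj C"
  using Dom_in_Obj Cod_in_Obj by (auto simp: Hom_def)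

lemma pullbackD:
  assumes "is_pullback C f g p q" and "f \<in> Hom C x u" and "g \<in> Hom C y u"
  shows "p \<in> Hom C (Dom C p) x" and "q \<in> Hom C (Dom C p) y" and "f \<odot> p = g \<odot> q"
  using assms by (auto simp: is_pullback_def Hom_iff)

lemma pullback_factor:
  assumes "is_pullback C f g p q" and "f \<in> Hom C x u" and "g \<in> Hom C y u"
    and "r \<in> Hom C w x" and "s \<in> Hom C w y" and "f \<odot> r = g \<odot> s"
  obtains t where "t \<in> Hom C w (Dom C p)" and "p \<odot> t = r" and "q \<odot> t = s"
proof -
  have "Dom C f = x" "Dom C g = y" using assms by (auto simp: Hom_iff)
  then have "\<exists>!t. t \<in> Hom C w (Dom C p) \<and> p \<odot> t = r \<and> q \<odot> t = s"
    using assms unfolding is_pullback_def by blast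
  then show thesis using that by blast
qed

lemma pullback_eq:
  assumes pb: "is_pullback C f g p q" and f: "f \<in> Hom C x u" and g: "g \<in> Hom C y u"
    and t: "t \<in> Hom C w (Dom C p)" and t': "t' \<in> Hom C w (Dom C p)"
    and "p \<odot> t = p \<odot> t'" and "q \<odot> t = q \<odot> t'"
  shows "t = t'"
proof -
  note pq = pullbackD[OF pb f g]
  have "f \<odot> (p \<odot> t') = g \<odot> (q \<odot> t')"
    using Comp_assoc[OF t' pq(1) f] Comp_assoc[OF t' pq(2) g] pq(3) by simp
  moreover have "p \<odot> t' \<in> Hom C w x" "q \<odot> t' \<in> Hom C w y"
    using Comp_in_Hom t' pq by blast+
  moreover have "Dom C f = x" "Dom C g = y" using f g by (auto simp: Hom_iff)
  ultimately have "\<exists>!s. s \<in> Hom C w (Dom C p) \<and> p \<odot> s = p \<odot> t' \<and> q \<odot> s = q \<odot> t'"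
    using pb unfolding is_pullback_def by blast
  then show ?thesis using assms by blast
qed

lemma pullbackI:
  assumes f: "f \<in> Hom C x u" and g: "g \<in> Hom C y u"
    and p: "p \<in> Hom C z x" and q: "q \<in> Hom C z y" and "f \<odot> p = g \<odot> q"
    and ex: "\<And>w r s. \<lbrakk>r \<in> Hom C w x; s \<in> Hom C w y; f \<odot> r = g \<odot> s\<rbrakk>
          \<Longrightarrow> \<exists>t \<in> Hom C w z. p \<odot> t = r \<and> q \<odot> t = s"
    and eq: "\<And>w t t'. \<lbrakk>t \<in> Hom C w z; t' \<in> Hom C w z; p \<odot> t = p \<odot> t'; q \<odot> t = q \<odot> t'\<rbrakk> \<Longrightarrow> t = t'"
  shows "is_pullback C f g p q"
proof -
  have doms: "f \<in> Arr C" "g \<in> Arr C" "Cod C f = Cod C g" "Dom C f = x" "Dom C g = y" "Dom C p = z"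
    using f g p by (auto simp: Hom_iff)
  have "\<exists>!t. t \<in> Hom C w z \<and> p \<odot> t = r \<and> q \<odot> t = s"
    if "r \<in> Hom C w x" "s \<in> Hom C w y" "f \<odot> r = g \<odot> s" for w r s
    using ex[OF that] eq by metis
  then show ?thesis using assms(1-5) doms unfolding is_pullback_def by simp
qed

lemma pullback_unique:
  assumes pb: "is_pullback C f g p q" and pb': "is_pullback C f g p' q'"
    and f: "f \<in> Hom C x u" and g: "g \<in> Hom C y u"
  obtains t where "t \<in> Hom C (Dom C p') (Dom C p)" and "iso C t" and "p \<odot> t = p'" and "q \<odot> t = q'"
proof -
  note pq = pullbackD[OF pb f g] and pq' = pullbackD[OF pb' f g]
  obtain t where t: "t \<in> Hom C (Dom C p') (Dom C p)" "p \<odot> t = p'" "q \<odot> t = q'"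
    using pullback_factor[OF pb f g pq'] by blast
  obtain s where s: "s \<in> Hom C (Dom C p) (Dom C p')" "p' \<odot> s = p" "q' \<odot> s = q"
    using pullback_factor[OF pb' f g pq] by blast
  have o: "Dom C p \<in> Obj C" "Dom C p' \<in> Obj C" using Hom_Obj pq(1) pq'(1) by blast+
  have "p \<odot> (t \<odot> s) = p \<odot> Id C (Dom C p)" "q \<odot> (t \<odot> s) = q \<odot> Id C (Dom C p)"
    using Comp_assoc[OF s(1) t(1) pq(1)] Comp_assoc[OF s(1) t(1) pq(2)] s t Comp_Id pq by simp_all
  then have ts: "t \<odot> s = Id C (Dom C p)"
    using pullback_eq[OF pb f g] Comp_in_Hom[OF s(1) t(1)] Id_in_Hom[OF o(1)] by blast
  have "p' \<odot> (s \<odot> t) = p' \<odot> Id C (Dom C p')" "q' \<odot> (s \<odot> t) = q' \<odot> Id C (Dom C p')"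
    using Comp_assoc[OF t(1) s(1) pq'(1)] Comp_assoc[OF t(1) s(1) pq'(2)] s t Comp_Id pq' by simp_all
  then have "s \<odot> t = Id C (Dom C p')"
    using pullback_eq[OF pb' f g] Comp_in_Hom[OF t(1) s(1)] Id_in_Hom[OF o(2)] by blast
  then have "iso C t" using s t ts unfolding iso_def by (auto simp: Hom_iff)
  then show thesis using that t by blast
qed

lemma iso_inverse:
  assumes "iso C t" and "t \<in> Hom C x y"
  obtains s where "s \<in> Hom C y x" and "s \<odot> t = Id C x" and "t \<odot> s = Id C y"
  using assms unfolding iso_def by (auto simp: Hom_iff)

lemma pullback_iso:
  assumes pb: "is_pullback C f g p q" and f: "f \<in> Hom C x u" and g: "g \<in> Hom C y u"
    and t: "t \<in> Hom C z (Dom C p)" "iso C t"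
  shows "is_pullback C f g (p \<odot> t) (q \<odot> t)"
proof -
  note pq = pullbackD[OF pb f g]
  obtain s where s: "s \<in> Hom C (Dom C p) z" "s \<odot> t = Id C z" "t \<odot> s = Id C (Dom C p)"
    using iso_inverse t by blast
  have pt: "p \<odot> t \<in> Hom C z x" "q \<odot> t \<in> Hom C z y" using Comp_in_Hom t pq by blast+
  have assoc: "(p \<odot> t) \<odot> k = p \<odot> (t \<odot> k)" "(q \<odot> t) \<odot> k = q \<odot> (t \<odot> k)"
    if "k \<in> Hom C w z" for k w using Comp_assoc that t pq by blast+
  show ?thesis
  proof (rule pullbackI[OF f g pt])
    show "f \<odot> (p \<odot> t) = g \<odot> (q \<odot> t)"
      using Comp_assoc[OF t(1) pq(1) f] Comp_assoc[OF t(1) pq(2) g] pq(3) by simp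
  next
    fix w r r' assume "r \<in> Hom C w x" "r' \<in> Hom C w y" "f \<odot> r = g \<odot> r'"
    then obtain k where k: "k \<in> Hom C w (Dom C p)" "p \<odot> k = r" "q \<odot> k = r'"
      using pullback_factor[OF pb f g] by blast
    have sk: "s \<odot> k \<in> Hom C w z" using Comp_in_Hom k s by blast
    have "t \<odot> (s \<odot> k) = k" using Comp_assoc[OF k(1) s(1) t(1)] s Id_Comp k by simp
    then show "\<exists>k \<in> Hom C w z. (p \<odot> t) \<odot> k = r \<and> (q \<odot> t) \<odot> k = r'"
      using sk assoc[OF sk] k by (intro bexI[of _ "s \<odot> k"]) simp_all
  next
    fix w k k' assume k: "k \<in> Hom C w z" "k' \<in> Hom C w z"
      and e: "(p \<odot> t) \<odot> k = (p \<odot> t) \<odot> k'" "(q \<odot> t) \<odot> k = (q \<odot> t) \<odot> k'"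
    have "t \<odot> k = t \<odot> k'"
      using pullback_eq[OF pb f g Comp_in_Hom[OF k(1) t(1)] Comp_in_Hom[OF k(2) t(1)]]
        e assoc[OF k(1)] assoc[OF k(2)] by simp
    then have "s \<odot> (t \<odot> k) = s \<odot> (t \<odot> k')" by simp
    then show "k = k'" using Comp_assoc[OF _ t(1) s(1)] k s Id_Comp by metis
  qed
qed

end

section \<open>Cartesian arrows\<close>

context cat_functor
begin

lemma cartesianD: "cartesian A B F f \<Longrightarrow> f \<in> Hom A (Dom A f) (Cod A f)"
  by (simp add: cartesian_def Hom_iff)

lemma cartesian_lift:
  assumes "cartesian A B F f" and "f \<in> Hom A x y" and "g \<in> Hom A z y"
    and "h \<in> Hom B (omap F z) (omap F x)" and "amap F f \<odot>\<^bsub>B\<^esub> h = amap F g"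
  obtains k where "k \<in> Hom A z x" and "amap F k = h" and "f \<odot>\<^bsub>A\<^esub> k = g"
proof -
  have "g \<in> Arr A" "Dom A g = z" "Dom A f = x" "Cod A g = Cod A f" using assms(2,3) by (auto simp: Hom_iff)
  then have "\<exists>!k. k \<in> Hom A z x \<and> amap F k = h \<and> f \<odot>\<^bsub>A\<^esub> k = g"
    using assms(1,4,5) unfolding cartesian_def by blast
  then show thesis using that by blast
qed

lemma cartesian_eq:
  assumes c: "cartesian A B F f" and f: "f \<in> Hom A x y"
    and k: "k \<in> Hom A z x" and k': "k' \<in> Hom A z x"
    and "amap F k = amap F k'" and "f \<odot>\<^bsub>A\<^esub> k = f \<odot>\<^bsub>A\<^esub> k'"
  shows "k = k'"
proof -
  have g: "f \<odot>\<^bsub>A\<^esub> k' \<in> Hom A z y" using A.Comp_in_Hom f k' by blast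
  have "\<exists>!l. l \<in> Hom A z x \<and> amap F l = amap F k' \<and> f \<odot>\<^bsub>A\<^esub> l = f \<odot>\<^bsub>A\<^esub> k'"
    using c[unfolded cartesian_def, THEN conjunct2, rule_format, of "f \<odot>\<^bsub>A\<^esub> k'" "amap F k'"]
      f g amap_in_Hom[OF k'] amap_Comp[OF k' f] by (simp add: Hom_iff)
  then show ?thesis using assms by blast
qed

lemma cartesianI:
  assumes f: "f \<in> Hom A x y"
    and ex: "\<And>z g h. \<lbrakk>g \<in> Hom A z y; h \<in> Hom B (omap F z) (omap F x); amap F f \<odot>\<^bsub>B\<^esub> h = amap F g\<rbrakk>
        \<Longrightarrow> \<exists>k \<in> Hom A z x. amap F k = h \<and> f \<odot>\<^bsub>A\<^esub> k = g"
    and eq: "\<And>z k k'. \<lbrakk>k \<in> Hom A z x; k' \<in> Hom A z x; amap F k = amap F k'; f \<odot>\<^bsub>A\<^esub> k = f \<odot>\<^bsub>A\<^esub> k'\<rbrakk>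
        \<Longrightarrow> k = k'"
  shows "cartesian A B F f"
  unfolding cartesian_def
proof (intro conjI ballI impI)
  show "f \<in> Arr A" using f by (simp add: Hom_iff)
next
  fix g h assume g: "g \<in> Arr A" and h: "h \<in> Hom B (omap F (Dom A g)) (omap F (Dom A f))"
    and "Cod A g = Cod A f \<and> amap F f \<odot>\<^bsub>B\<^esub> h = amap F g"
  moreover have "g \<in> Hom A (Dom A g) y" using calculation f by (simp add: Hom_iff)
  moreover have x: "Dom A f = x" using f by (simp add: Hom_iff)
  ultimately obtain k where k: "k \<in> Hom A (Dom A g) x" "amap F k = h" "f \<odot>\<^bsub>A\<^esub> k = g"
    using ex by metis
  then show "\<exists>!k. k \<in> Hom A (Dom A g) (Dom A f) \<and> amap F k = h \<and> f \<odot>\<^bsub>A\<^esub> k = g"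
    using eq x by metis
qed

lemma cartesian_Comp:
  assumes f: "cartesian A B F f" "f \<in> Hom A x y" and g: "cartesian A B F g" "g \<in> Hom A y z"
  shows "cartesian A B F (g \<odot>\<^bsub>A\<^esub> f)"
proof (rule cartesianI[OF A.Comp_in_Hom[OF f(2) g(2)]])
  fix w l h assume l: "l \<in> Hom A w z" and h: "h \<in> Hom B (omap F w) (omap F x)"
    and e: "amap F (g \<odot>\<^bsub>A\<^esub> f) \<odot>\<^bsub>B\<^esub> h = amap F l"
  note Ff = amap_in_Hom[OF f(2)] and Fg = amap_in_Hom[OF g(2)]
  have "amap F g \<odot>\<^bsub>B\<^esub> (amap F f \<odot>\<^bsub>B\<^esub> h) = amap F l"
    using e amap_Comp[OF f(2) g(2)] B.Comp_assoc[OF h Ff Fg] by simp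
  then obtain m where m: "m \<in> Hom A w y" "amap F m = amap F f \<odot>\<^bsub>B\<^esub> h" "g \<odot>\<^bsub>A\<^esub> m = l"
    using cartesian_lift[OF g l B.Comp_in_Hom[OF h Ff]] by blast
  obtain k where k: "k \<in> Hom A w x" "amap F k = h" "f \<odot>\<^bsub>A\<^esub> k = m"
    using cartesian_lift[OF f m(1) h] m(2) by metis
  then show "\<exists>k \<in> Hom A w x. amap F k = h \<and> (g \<odot>\<^bsub>A\<^esub> f) \<odot>\<^bsub>A\<^esub> k = l"
    using A.Comp_assoc[OF k(1) f(2) g(2)] m(3) by auto
next
  fix w k k' assume k: "k \<in> Hom A w x" "k' \<in> Hom A w x" and e: "amap F k = amap F k'"
    and "(g \<odot>\<^bsub>A\<^esub> f) \<odot>\<^bsub>A\<^esub> k = (g \<odot>\<^bsub>A\<^esub> f) \<odot>\<^bsub>A\<^esub> k'"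
  then have "g \<odot>\<^bsub>A\<^esub> (f \<odot>\<^bsub>A\<^esub> k) = g \<odot>\<^bsub>A\<^esub> (f \<odot>\<^bsub>A\<^esub> k')"
    using A.Comp_assoc f(2) g(2) by metis
  moreover have "amap F (f \<odot>\<^bsub>A\<^esub> k) = amap F (f \<odot>\<^bsub>A\<^esub> k')" using amap_Comp k f(2) e by metis
  ultimately have "f \<odot>\<^bsub>A\<^esub> k = f \<odot>\<^bsub>A\<^esub> k'"
    using cartesian_eq[OF g] A.Comp_in_Hom k f(2) by metis
  then show "k = k'" using cartesian_eq[OF f] k e by blast
qed

lemma cartesian_cancel:
  assumes f: "f \<in> Hom A x y" and g: "cartesian A B F g" "g \<in> Hom A y z"
    and gf: "cartesian A B F (g \<odot>\<^bsub>A\<^esub> f)"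
  shows "cartesian A B F f"
proof (rule cartesianI[OF f])
  note gfH = A.Comp_in_Hom[OF f g(2)] and Ff = amap_in_Hom[OF f] and Fg = amap_in_Hom[OF g(2)]
  fix w l h assume l: "l \<in> Hom A w y" and h: "h \<in> Hom B (omap F w) (omap F x)"
    and e: "amap F f \<odot>\<^bsub>B\<^esub> h = amap F l"
  have "amap F (g \<odot>\<^bsub>A\<^esub> f) \<odot>\<^bsub>B\<^esub> h = amap F (g \<odot>\<^bsub>A\<^esub> l)"
    using e amap_Comp[OF f g(2)] amap_Comp[OF l g(2)] B.Comp_assoc[OF h Ff Fg] by simp
  then obtain k where k: "k \<in> Hom A w x" "amap F k = h" "(g \<odot>\<^bsub>A\<^esub> f) \<odot>\<^bsub>A\<^esub> k = g \<odot>\<^bsub>A\<^esub> l"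
    using cartesian_lift[OF gf gfH A.Comp_in_Hom[OF l g(2)] h] by blast
  have "f \<odot>\<^bsub>A\<^esub> k = l"
    using cartesian_eq[OF g A.Comp_in_Hom[OF k(1) f] l] k e amap_Comp[OF k(1) f] A.Comp_assoc[OF k(1) f g(2)]
    by simp
  then show "\<exists>k \<in> Hom A w x. amap F k = h \<and> f \<odot>\<^bsub>A\<^esub> k = l" using k by blast
next
  note gfH = A.Comp_in_Hom[OF f g(2)]
  fix w k k' assume k: "k \<in> Hom A w x" "k' \<in> Hom A w x" and "amap F k = amap F k'"
    and "f \<odot>\<^bsub>A\<^esub> k = f \<odot>\<^bsub>A\<^esub> k'"
  moreover have "(g \<odot>\<^bsub>A\<^esub> f) \<odot>\<^bsub>A\<^esub> k = (g \<odot>\<^bsub>A\<^esub> f) \<odot>\<^bsub>A\<^esub> k'"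
    using A.Comp_assoc[OF k(1) f g(2)] A.Comp_assoc[OF k(2) f g(2)] calculation by simp
  ultimately show "k = k'" using cartesian_eq[OF gf gfH] by blast
qed

lemma amap_iso:
  assumes "iso A t" and t: "t \<in> Hom A x y"
  shows "iso B (amap F t)"
proof -
  obtain s where s: "s \<in> Hom A y x" "s \<odot>\<^bsub>A\<^esub> t = Id A x" "t \<odot>\<^bsub>A\<^esub> s = Id A y"
    using A.iso_inverse assms by blast
  have "amap F s \<odot>\<^bsub>B\<^esub> amap F t = Id B (omap F x)" "amap F t \<odot>\<^bsub>B\<^esub> amap F s = Id B (omap F y)"
    using amap_Comp[OF t s(1)] amap_Comp[OF s(1) t] s amap_Id A.Hom_Obj[OF t] by simp_all
  then show ?thesis using amap_in_Hom[OF t] amap_in_Hom[OF s(1)] unfolding iso_def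
    by (auto simp: Hom_iff)
qed

lemma iso_cartesian:
  assumes "iso A t" and t: "t \<in> Hom A x y"
  shows "cartesian A B F t"
proof (rule cartesianI[OF t])
  obtain s where s: "s \<in> Hom A y x" "s \<odot>\<^bsub>A\<^esub> t = Id A x" "t \<odot>\<^bsub>A\<^esub> s = Id A y"
    using A.iso_inverse assms by blast
  {
    fix z g h assume g: "g \<in> Hom A z y" and h: "h \<in> Hom B (omap F z) (omap F x)"
      and e: "amap F t \<odot>\<^bsub>B\<^esub> h = amap F g"
    have sg: "s \<odot>\<^bsub>A\<^esub> g \<in> Hom A z x" using A.Comp_in_Hom g s by blast
    have 1: "t \<odot>\<^bsub>A\<^esub> (s \<odot>\<^bsub>A\<^esub> g) = g"
      using A.Comp_assoc[OF g s(1) t] s A.Id_Comp[OF g] by simp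
    have "amap F (s \<odot>\<^bsub>A\<^esub> g) = (amap F s \<odot>\<^bsub>B\<^esub> amap F t) \<odot>\<^bsub>B\<^esub> h"
      using amap_Comp[OF g s(1)] e B.Comp_assoc[OF h amap_in_Hom[OF t] amap_in_Hom[OF s(1)]] by simp
    also have "\<dots> = h"
      using amap_Comp[OF t s(1)] s(2) amap_Id A.Hom_Obj[OF t] B.Id_Comp[OF h] by simp
    finally show "\<exists>k \<in> Hom A z x. amap F k = h \<and> t \<odot>\<^bsub>A\<^esub> k = g" using sg 1 by blast
  next
    fix z k k' assume k: "k \<in> Hom A z x" "k' \<in> Hom A z x" and "t \<odot>\<^bsub>A\<^esub> k = t \<odot>\<^bsub>A\<^esub> k'"
    then have "s \<odot>\<^bsub>A\<^esub> (t \<odot>\<^bsub>A\<^esub> k) = s \<odot>\<^bsub>A\<^esub> (t \<odot>\<^bsub>A\<^esub> k')" by simp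
    then show "k = k'" using A.Comp_assoc[OF _ t s(1)] k s A.Id_Comp by metis
  }
qed

text \<open>
  A pair of arrows into \<open>x\<close> and \<open>y\<close> induces an arrow into the fibre product of the base. It
  lifts along the cartesian arrow \<open>p\<close>, and the other triangle commutes because \<open>g\<close> is cartesian:
  both sides have the same image in the base and the same composite with \<open>g\<close>.
\<close>

lemma cartesian_pullback:
  assumes f: "f \<in> Hom A x u" and g: "cartesian A B F g" "g \<in> Hom A y u"
    and p: "cartesian A B F p" "p \<in> Hom A z x" and q: "q \<in> Hom A z y"
    and comm: "f \<odot>\<^bsub>A\<^esub> p = g \<odot>\<^bsub>A\<^esub> q"
    and pb: "is_pullback B (amap F f) (amap F g) (amap F p) (amap F q)"
  shows "is_pullback A f g p q"
proof (rule A.pullbackI[OF f g(2) p(2) q comm])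
  note F = amap_in_Hom[OF f] amap_in_Hom[OF g(2)] and Fp = amap_in_Hom[OF p(2)] amap_in_Hom[OF q]
  have [simp]: "Dom B (amap F p) = omap F z" using Fp(1) by (simp add: Hom_iff)
  {
    fix w r s assume r: "r \<in> Hom A w x" and s: "s \<in> Hom A w y" and e: "f \<odot>\<^bsub>A\<^esub> r = g \<odot>\<^bsub>A\<^esub> s"
    have "amap F f \<odot>\<^bsub>B\<^esub> amap F r = amap F g \<odot>\<^bsub>B\<^esub> amap F s"
      using amap_Comp r s f g(2) e by metis
    then obtain h where h: "h \<in> Hom B (omap F w) (omap F z)" "amap F p \<odot>\<^bsub>B\<^esub> h = amap F r"
        "amap F q \<odot>\<^bsub>B\<^esub> h = amap F s"
      using B.pullback_factor[OF pb F amap_in_Hom[OF r] amap_in_Hom[OF s]] by auto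
    obtain k where k: "k \<in> Hom A w z" "amap F k = h" "p \<odot>\<^bsub>A\<^esub> k = r"
      using cartesian_lift[OF p r h(1,2)] by blast
    have "g \<odot>\<^bsub>A\<^esub> (q \<odot>\<^bsub>A\<^esub> k) = g \<odot>\<^bsub>A\<^esub> s"
      using A.Comp_assoc[OF k(1) q g(2)] A.Comp_assoc[OF k(1) p(2) f] comm e k(3) by simp
    moreover have "amap F (q \<odot>\<^bsub>A\<^esub> k) = amap F s" using amap_Comp[OF k(1) q] k(2) h(3) by simp
    ultimately have "q \<odot>\<^bsub>A\<^esub> k = s" using cartesian_eq[OF g A.Comp_in_Hom[OF k(1) q] s] by blast
    then show "\<exists>t \<in> Hom A w z. p \<odot>\<^bsub>A\<^esub> t = r \<and> q \<odot>\<^bsub>A\<^esub> t = s" using k by blast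
  next
    fix w t t' assume t: "t \<in> Hom A w z" "t' \<in> Hom A w z"
      and e: "p \<odot>\<^bsub>A\<^esub> t = p \<odot>\<^bsub>A\<^esub> t'" "q \<odot>\<^bsub>A\<^esub> t = q \<odot>\<^bsub>A\<^esub> t'"
    have "amap F t = amap F t'"
    proof (rule B.pullback_eq[OF pb F])
      show "amap F t \<in> Hom B (omap F w) (Dom B (amap F p))"
        "amap F t' \<in> Hom B (omap F w) (Dom B (amap F p))" using amap_in_Hom t by simp_all
      show "amap F p \<odot>\<^bsub>B\<^esub> amap F t = amap F p \<odot>\<^bsub>B\<^esub> amap F t'"
        "amap F q \<odot>\<^bsub>B\<^esub> amap F t = amap F q \<odot>\<^bsub>B\<^esub> amap F t'"
        using amap_Comp t p(2) q e by metis+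
    qed
    then show "t = t'" using cartesian_eq[OF p] t e by blast
  }
qed

end

locale fibration = cat_functor E B P
  for E :: "('e, 'f) category" and B :: "('o, 'a) category" and P +
  assumes lift_exists: "\<lbrakk>y \<in> Obj E; f \<in> Hom B u (omap P y)\<rbrakk>
      \<Longrightarrow> \<exists>x. \<exists>g \<in> Hom E x y. cartesian E B P g \<and> amap P g = f \<and> omap P x = u"

lemma fibered_iff_fibration: "fibered E B P \<longleftrightarrow> fibration E B P"
proof
  assume f: "fibered E B P"
  then interpret cat_functor E B P by (simp add: fibered_def)
  show "fibration E B P"
  proof
    fix y f u assume y: "y \<in> Obj E" "f \<in> Hom B u (omap P y)"
    then obtain g where g: "cartesian E B P g" "Cod E g = y" "amap P g = f"
      using f unfolding fibered_def Hom_iff by blast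
    moreover have "g \<in> Hom E (Dom E g) y" using cartesianD g by blast
    moreover have "omap P (Dom E g) = u" using amap_in_Hom[OF calculation(4)] g y by (simp add: Hom_iff)
    ultimately show "\<exists>x. \<exists>g \<in> Hom E x y. cartesian E B P g \<and> amap P g = f \<and> omap P x = u" by blast
  qed
next
  assume "fibration E B P"
  then interpret fibration E B P .
  show "fibered E B P" unfolding fibered_def
  proof (intro conjI ballI impI)
    show "cat_functor E B P" by unfold_locales
    fix y f assume "y \<in> Obj E" "f \<in> Arr B" "Cod B f = omap P y"
    then show "\<exists>g. cartesian E B P g \<and> Cod E g = y \<and> amap P g = f"
      using lift_exists[of y f "Dom B f"] by (auto simp: Hom_iff)
  qed
qed

context fibration
begin

text \<open>
  The converse of \<open>cartesian_pullback\<close>, as soon as the base has a fibre product: lifting that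
  one gives a fibre product upstairs, and any other is isomorphic to it.
\<close>

lemma pullback_image:
  assumes pb: "is_pullback E f g p q" and f: "f \<in> Hom E x u" and g: "cartesian E B P g" "g \<in> Hom E y u"
    and ex: "\<exists>p q. is_pullback B (amap P f) (amap P g) p q"
  shows "is_pullback B (amap P f) (amap P g) (amap P p) (amap P q)" and "cartesian E B P p"
proof -
  obtain p0 q0 where pb0: "is_pullback B (amap P f) (amap P g) p0 q0" using ex by blast
  note F = amap_in_Hom[OF f] amap_in_Hom[OF g(2)]
  note pq0 = B.pullbackD[OF pb0 F]
  obtain z p1 where p1: "p1 \<in> Hom E z x" "cartesian E B P p1" "amap P p1 = p0" "omap P z = Dom B p0"
    using lift_exists[OF _ pq0(1)] A.Hom_Obj[OF f] by blast
  have fp: "f \<odot>\<^bsub>E\<^esub> p1 \<in> Hom E z u" using A.Comp_in_Hom f p1 by blast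
  obtain q1 where q1: "q1 \<in> Hom E z y" "amap P q1 = q0" "g \<odot>\<^bsub>E\<^esub> q1 = f \<odot>\<^bsub>E\<^esub> p1"
    using cartesian_lift[OF g fp] pq0 p1 amap_Comp[OF p1(1) f] by metis
  have pb1: "is_pullback E f g p1 q1"
    using cartesian_pullback[OF f g p1(2,1) q1(1)] q1 p1 pb0 by simp
  obtain t where t: "t \<in> Hom E (Dom E p) (Dom E p1)" "iso E t" "p1 \<odot>\<^bsub>E\<^esub> t = p" "q1 \<odot>\<^bsub>E\<^esub> t = q"
    using A.pullback_unique[OF pb1 pb f g(2)] by blast
  have z: "Dom E p1 = z" using p1 by (simp add: Hom_iff)
  have Pt: "amap P t \<in> Hom B (omap P (Dom E p)) (Dom B p0)" "iso B (amap P t)"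
    using amap_in_Hom[OF t(1)] amap_iso[OF t(2,1)] z p1(4) by simp_all
  have "amap P p = p0 \<odot>\<^bsub>B\<^esub> amap P t" "amap P q = q0 \<odot>\<^bsub>B\<^esub> amap P t"
    using amap_Comp[OF t(1)] t z p1 q1 by auto
  then show "is_pullback B (amap P f) (amap P g) (amap P p) (amap P q)"
    using B.pullback_iso[OF pb0 F Pt] by simp
  show "cartesian E B P p"
    using cartesian_Comp[OF iso_cartesian[OF t(2,1)] t(1) p1(2)] p1(1) t(3) z by simp
qed

end

text \<open>
  An arrow factors through a cartesian lift of its image by an arrow of a fibre. If this is
  always invertible, then the arrow itself is cartesian. Conversely an arrow of a fibre that is
  cartesian has an inverse, namely the lift of the identity.
\<close>

lemma fibered_in_groupoids_iff:
  "fibered_in_groupoids E B P \<longleftrightarrow> fibration E B P \<and> (\<forall>f \<in> Arr E. cartesian E B P f)"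
proof (intro iffI conjI ballI)
  assume h: "fibered_in_groupoids E B P"
  then show fib: "fibration E B P" by (simp add: fibered_in_groupoids_def fibered_iff_fibration)
  then interpret fibration E B P .
  fix f assume f: "f \<in> Arr E"
  note fH = A.Arr_Hom[OF f]
  let ?x = "Dom E f" and ?y = "Cod E f"
  obtain z g where g: "g \<in> Hom E z ?y" "cartesian E B P g" "amap P g = amap P f" "omap P z = omap P ?x"
    using lift_exists[OF _ amap_in_Hom[OF fH]] A.Hom_Obj[OF fH] by blast
  have o: "omap P ?x \<in> Obj B" using B.Hom_Obj[OF amap_in_Hom[OF fH]] by blast
  obtain k where k: "k \<in> Hom E ?x z" "amap P k = Id B (omap P ?x)" "g \<odot>\<^bsub>E\<^esub> k = f"
    using cartesian_lift[OF g(2,1) fH] B.Id_in_Hom[OF o] B.Comp_Id amap_in_Hom[OF fH] g by metis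
  have "iso (fiber E B P (omap P ?x)) k"
    using h o k by (simp add: fibered_in_groupoids_def groupoid_def fiber_def Hom_iff)
  then have "iso E k" by (auto simp: iso_def fiber_def Hom_iff)
  then show "cartesian E B P f" using cartesian_Comp[OF iso_cartesian k(1) g(2,1)] k by metis
next
  assume h: "fibration E B P \<and> (\<forall>f \<in> Arr E. cartesian E B P f)"
  then interpret fibration E B P by blast
  have "groupoid (fiber E B P U)" if U: "U \<in> Obj B" for U
  proof -
    let ?G = "fiber E B P U"
    have eqU: "omap P x = U \<and> omap P y = U" if "f \<in> Hom E x y" "amap P f = Id B U" for f x y
      using amap_in_Hom[OF that(1)] B.Id_in_Hom[OF U] that(2) by (simp add: Hom_iff)
    have Hom: "f \<in> Hom ?G x y \<longleftrightarrow> f \<in> Hom E x y \<and> amap P f = Id B U" for f x y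
      by (auto simp: fiber_def Hom_iff)
    have Obj: "x \<in> Obj ?G \<longleftrightarrow> x \<in> Obj E \<and> omap P x = U" for x by (simp add: fiber_def)
    have [simp]: "Comp ?G = Comp E" "Id ?G = Id E" "Dom ?G = Dom E" "Cod ?G = Cod E"
      by (simp_all add: fiber_def)
    have cat: "category ?G"
    proof
      fix f assume "f \<in> Arr ?G"
      then show "Dom ?G f \<in> Obj ?G" "Cod ?G f \<in> Obj ?G"
        using eqU[OF A.Arr_Hom] A.Dom_in_Obj A.Cod_in_Obj by (auto simp: fiber_def)
    next
      fix x assume "x \<in> Obj ?G" then show "Id ?G x \<in> Hom ?G x x"
        unfolding Hom Obj using A.Id_in_Hom amap_Id by auto
    next
      fix f g x y z assume f: "f \<in> Hom ?G x y" "g \<in> Hom ?G y z"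
      then show "g \<odot>\<^bsub>?G\<^esub> f \<in> Hom ?G x z"
        unfolding Hom using A.Comp_in_Hom[of f x y g z] amap_Comp[of f x y g z] B.Comp_Id[OF B.Id_in_Hom[OF U]]
        by auto
    qed (auto simp: Hom A.Comp_Id A.Id_Comp intro: A.Comp_assoc)
    have "iso ?G f" if f: "f \<in> Arr ?G" for f
    proof -
      have fE: "f \<in> Hom E (Dom E f) (Cod E f)" "amap P f = Id B U" using f by (simp_all add: fiber_def Hom_iff)
      note u = eqU[OF fE] and c = conjunct2[OF h, THEN bspec, of f]
      have cf: "cartesian E B P f" using c f by (simp add: fiber_def)
      note o = A.Hom_Obj[OF fE(1)]
      have IU: "Id B U \<odot>\<^bsub>B\<^esub> Id B U = Id B U" using B.Comp_Id[OF B.Id_in_Hom[OF U]] .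
      obtain g where g: "g \<in> Hom E (Cod E f) (Dom E f)" "amap P g = Id B U" "f \<odot>\<^bsub>E\<^esub> g = Id E (Cod E f)"
        using cartesian_lift[OF cf fE(1) A.Id_in_Hom, where h = "Id B U"] o u fE(2) IU amap_Id B.Id_in_Hom[OF U]
        by auto
      have "g \<odot>\<^bsub>E\<^esub> f = Id E (Dom E f)"
      proof (rule cartesian_eq[OF cf fE(1)])
        show "g \<odot>\<^bsub>E\<^esub> f \<in> Hom E (Dom E f) (Dom E f)" using A.Comp_in_Hom fE g by blast
        show "Id E (Dom E f) \<in> Hom E (Dom E f) (Dom E f)" using A.Id_in_Hom o by blast
        show "amap P (g \<odot>\<^bsub>E\<^esub> f) = amap P (Id E (Dom E f))"
          using amap_Comp[OF fE(1) g(1)] fE(2) g(2) IU amap_Id o u by simp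
        show "f \<odot>\<^bsub>E\<^esub> (g \<odot>\<^bsub>E\<^esub> f) = f \<odot>\<^bsub>E\<^esub> Id E (Dom E f)"
          using A.Comp_assoc[OF fE(1) g(1) fE(1)] g(3) A.Id_Comp[OF fE(1)] A.Comp_Id[OF fE(1)] by simp
      qed
      then show ?thesis unfolding iso_def Bex_def Hom using f g by auto
    qed
    then show ?thesis using cat by (simp add: groupoid_def)
  qed
  then show "fibered_in_groupoids E B P"
    using fibration_axioms by (simp add: fibered_in_groupoids_def fibered_iff_fibration)
qed

section \<open>Transport of descent data along functors\<close>

definition descent_image ::
  "('e, 'f, 'p, 'g) functor_maps \<Rightarrow> ('i, 'e, 'f) descent_data \<Rightarrow> ('i, 'p, 'g) descent_data" where
  "descent_image G D = \<lparr>local_obj = (\<lambda>i. omap G (local_obj D i)),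
     res1 = (\<lambda>i j. amap G (res1 D i j)), res2 = (\<lambda>i j. amap G (res2 D i j))\<rparr>"

lemma descent_image_simps [simp]:
  "local_obj (descent_image G D) i = omap G (local_obj D i)"
  "res1 (descent_image G D) i j = amap G (res1 D i j)"
  "res2 (descent_image G D) i j = amap G (res2 D i j)"
  by (simp_all add: descent_image_def)

lemma descent_datum_localD:
  assumes "descent_datum E B P I \<sigma> D" and "i \<in> I"
  shows "local_obj D i \<in> Obj E" and "omap P (local_obj D i) = Dom B (\<sigma> i)"
  using assms by (auto simp: descent_datum_def)

lemma descent_datum_overlapD:
  assumes "descent_datum E B P I \<sigma> D" and "i \<in> I" and "j \<in> I"
  shows "cartesian E B P (res1 D i j)" and "res1 D i j \<in> Hom E (overlap_obj E D i j) (local_obj D i)"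
    and "cartesian E B P (res2 D i j)" and "res2 D i j \<in> Hom E (overlap_obj E D i j) (local_obj D j)"
    and "is_pullback B (\<sigma> i) (\<sigma> j) (amap P (res1 D i j)) (amap P (res2 D i j))"
  using assms by (auto simp: descent_datum_def)

lemma restricts_toD:
  assumes "restricts_to E B P U I \<sigma> x \<rho> D"
  shows "x \<in> Obj E" and "omap P x = U"
    and "i \<in> I \<Longrightarrow> cartesian E B P (\<rho> i)" and "i \<in> I \<Longrightarrow> \<rho> i \<in> Hom E (local_obj D i) x"
    and "i \<in> I \<Longrightarrow> amap P (\<rho> i) = \<sigma> i"
    and "\<lbrakk>i \<in> I; j \<in> I\<rbrakk> \<Longrightarrow> \<rho> i \<odot>\<^bsub>E\<^esub> res1 D i j = \<rho> j \<odot>\<^bsub>E\<^esub> res2 D i j"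
  using assms by (auto simp: restricts_to_def)

text \<open>
  A functor preserves all the equations in a descent datum, so only cartesian arrows and fibre
  products are at stake. These conditions are imposed on the arrows that occur in a datum and
  not on the functor as a whole, because the projection of \<open>\<Phi>\<close> to \<open>FL\<close> violates them: every
  arrow of \<open>\<Phi>\<close> is cartesian over \<open>FL\<close>, but its image in \<open>FL\<close> may be any arrow. The third arrow
  of a cocycle is then cartesian by cancellation.
\<close>

lemma descent_datum_image:
  assumes G: "cat_functor E E' G" and P': "cat_functor E' B' P'" and D: "descent_datum E B P I \<sigma> D"
    and obj: "\<And>i. i \<in> I \<Longrightarrow> omap P' (omap G (local_obj D i)) = Dom B' (\<sigma>' i)"
    and double: "\<And>i j. \<lbrakk>i \<in> I; j \<in> I\<rbrakk> \<Longrightarrow>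
        cartesian E' B' P' (amap G (res1 D i j)) \<and> cartesian E' B' P' (amap G (res2 D i j)) \<and>
        is_pullback B' (\<sigma>' i) (\<sigma>' j) (amap P' (amap G (res1 D i j))) (amap P' (amap G (res2 D i j)))"
    and triple: "\<And>i j k z a b. \<lbrakk>i \<in> I; j \<in> I; k \<in> I;
        cartesian E B P a; a \<in> Hom E z (overlap_obj E D i j);
        cartesian E B P b; b \<in> Hom E z (overlap_obj E D j k);
        res2 D i j \<odot>\<^bsub>E\<^esub> a = res1 D j k \<odot>\<^bsub>E\<^esub> b;
        is_pullback B (amap P (res2 D i j)) (amap P (res1 D j k)) (amap P a) (amap P b)\<rbrakk> \<Longrightarrow>
        cartesian E' B' P' (amap G a) \<and> cartesian E' B' P' (amap G b) \<and>
        is_pullback B' (amap P' (amap G (res2 D i j))) (amap P' (amap G (res1 D j k)))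
          (amap P' (amap G a)) (amap P' (amap G b))"
  shows "descent_datum E' B' P' I \<sigma>' (descent_image G D)"
proof -
  interpret G: cat_functor E E' G by fact
  interpret P': cat_functor E' B' P' by fact
  note loc = descent_datum_localD[OF D] and ov = descent_datum_overlapD[OF D]
  have ovG: "overlap_obj E' (descent_image G D) i j = omap G (overlap_obj E D i j)"
    if "i \<in> I" "j \<in> I" for i j
    using G.amap_in_Hom[OF ov(2)[OF that]] by (simp add: overlap_obj_def Hom_iff)
  have "cocycle E' B' P' (descent_image G D) i j k" if ijk: "i \<in> I" "j \<in> I" "k \<in> I" for i j k
  proof -
    obtain z a b c where a: "cartesian E B P a" "a \<in> Hom E z (overlap_obj E D i j)"
      and b: "cartesian E B P b" "b \<in> Hom E z (overlap_obj E D j k)"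
      and c: "c \<in> Hom E z (overlap_obj E D i k)"
      and pb: "is_pullback B (amap P (res2 D i j)) (amap P (res1 D j k)) (amap P a) (amap P b)"
      and e: "res1 D i j \<odot>\<^bsub>E\<^esub> a = res1 D i k \<odot>\<^bsub>E\<^esub> c" "res2 D i j \<odot>\<^bsub>E\<^esub> a = res1 D j k \<odot>\<^bsub>E\<^esub> b"
        "res2 D j k \<odot>\<^bsub>E\<^esub> b = res2 D i k \<odot>\<^bsub>E\<^esub> c"
    proof -
      have "cocycle E B P D i j k" using D ijk by (auto simp: descent_datum_def)
      then show thesis using that unfolding cocycle_def by blast
    qed
    have tr: "cartesian E' B' P' (amap G a)" "cartesian E' B' P' (amap G b)"
      "is_pullback B' (amap P' (amap G (res2 D i j))) (amap P' (amap G (res1 D j k)))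
          (amap P' (amap G a)) (amap P' (amap G b))"
      using triple[OF ijk a b e(2) pb] by auto
    have Ge: "amap G (res1 D i j) \<odot>\<^bsub>E'\<^esub> amap G a = amap G (res1 D i k) \<odot>\<^bsub>E'\<^esub> amap G c"
      "amap G (res2 D i j) \<odot>\<^bsub>E'\<^esub> amap G a = amap G (res1 D j k) \<odot>\<^bsub>E'\<^esub> amap G b"
      "amap G (res2 D j k) \<odot>\<^bsub>E'\<^esub> amap G b = amap G (res2 D i k) \<odot>\<^bsub>E'\<^esub> amap G c"
      using G.amap_Comp[OF a(2) ov(2)[OF ijk(1,2)]] G.amap_Comp[OF c ov(2)[OF ijk(1,3)]]
        G.amap_Comp[OF a(2) ov(4)[OF ijk(1,2)]] G.amap_Comp[OF b(2) ov(2)[OF ijk(2,3)]]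
        G.amap_Comp[OF b(2) ov(4)[OF ijk(2,3)]] G.amap_Comp[OF c ov(4)[OF ijk(1,3)]] e
      by metis+
    note H = G.amap_in_Hom[OF a(2)] G.amap_in_Hom[OF b(2)] G.amap_in_Hom[OF c]
    have "cartesian E' B' P' (amap G (res1 D i k) \<odot>\<^bsub>E'\<^esub> amap G c)"
      using P'.cartesian_Comp[OF tr(1) H(1) _ G.amap_in_Hom[OF ov(2)]] double ijk Ge(1) by metis
    then have "cartesian E' B' P' (amap G c)"
      using P'.cartesian_cancel[OF H(3) _ G.amap_in_Hom[OF ov(2)]] double ijk by blast
    then show ?thesis unfolding cocycle_def
      using H tr Ge ovG ijk by (intro exI[of _ "omap G z"] exI[of _ "amap G a"] exI[of _ "amap G b"]
          exI[of _ "amap G c"]) simp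
  qed
  moreover have "res1 (descent_image G D) i j \<in>
        Hom E' (overlap_obj E' (descent_image G D) i j) (local_obj (descent_image G D) i)"
      "res2 (descent_image G D) i j \<in>
        Hom E' (overlap_obj E' (descent_image G D) i j) (local_obj (descent_image G D) j)"
    if "i \<in> I" "j \<in> I" for i j
    using ovG[OF that] G.amap_in_Hom[OF ov(2)[OF that]] G.amap_in_Hom[OF ov(4)[OF that]] by simp_all
  ultimately show ?thesis unfolding descent_datum_def
    using loc(1) G.omap_in_Obj obj double by simp
qed

lemma restricts_to_image:
  assumes G: "cat_functor E E' G" and D: "descent_datum E B P I \<sigma> D"
    and r: "restricts_to E B P U I \<sigma> x \<rho> D"
    and "omap P' (omap G x) = U'"
    and "\<And>i. i \<in> I \<Longrightarrow> cartesian E' B' P' (amap G (\<rho> i)) \<and> amap P' (amap G (\<rho> i)) = \<sigma>' i"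
  shows "restricts_to E' B' P' U' I \<sigma>' (omap G x) (\<lambda>i. amap G (\<rho> i)) (descent_image G D)"
proof -
  interpret G: cat_functor E E' G by fact
  note r' = restricts_toD[OF r] and ov = descent_datum_overlapD[OF D]
  have "amap G (\<rho> i) \<odot>\<^bsub>E'\<^esub> amap G (res1 D i j) = amap G (\<rho> j) \<odot>\<^bsub>E'\<^esub> amap G (res2 D i j)"
    if "i \<in> I" "j \<in> I" for i j
    using G.amap_Comp[OF ov(2) r'(4)] G.amap_Comp[OF ov(4) r'(4)] r'(6) that by metis
  then show ?thesis unfolding restricts_to_def
    using assms r' G.omap_in_Obj G.amap_in_Hom by simp
qed

section \<open>Descent of arrows\<close>

text \<open>
  Descent of morphisms for a single datum: between two objects that restrict to the same datum
  there is exactly one arrow over the identity that is compatible with the restrictions. When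
  all arrows are cartesian, this is all of it, since a morphism \<open>\<alpha>\<close> from the datum of \<open>x\<close> to the
  datum of \<open>x'\<close> turns restriction arrows \<open>\<rho>'\<^sub>i\<close> of \<open>x'\<close> into restriction arrows \<open>\<rho>'\<^sub>i \<alpha>\<^sub>i\<close> to the
  first datum. This form leaves one datum to transport between fibrations, where the general one
  would also ask for a second datum over the same fibre products and a morphism.
\<close>

definition descent_of_arrows ::
  "('e, 'f) category \<Rightarrow> ('o, 'a) category \<Rightarrow> ('e, 'f, 'o, 'a) functor_maps
    \<Rightarrow> 'o \<Rightarrow> 'i set \<Rightarrow> ('i \<Rightarrow> 'a) \<Rightarrow> bool" where
  "descent_of_arrows E B P U I \<sigma> \<longleftrightarrow>
     (\<forall>D x \<rho> y \<kappa>. descent_datum E B P I \<sigma> D \<and> restricts_to E B P U I \<sigma> x \<rho> D \<and>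
        restricts_to E B P U I \<sigma> y \<kappa> D \<longrightarrow>
        (\<exists>!h. h \<in> Hom E x y \<and> amap P h = Id B U \<and> (\<forall>i \<in> I. h \<odot>\<^bsub>E\<^esub> \<rho> i = \<kappa> i)))"

lemma descent_of_arrowsD:
  assumes "descent_of_arrows E B P U I \<sigma>" and "descent_datum E B P I \<sigma> D"
    and "restricts_to E B P U I \<sigma> x \<rho> D" and "restricts_to E B P U I \<sigma> y \<kappa> D"
  shows "\<exists>!h. h \<in> Hom E x y \<and> amap P h = Id B U \<and> (\<forall>i \<in> I. h \<odot>\<^bsub>E\<^esub> \<rho> i = \<kappa> i)"
  using assms unfolding descent_of_arrows_def by blast

context cat_functor
begin

lemma descent_of_morphisms_imp_arrows:
  assumes mor: "descent_of_morphisms A B F U I \<sigma>"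
  shows "descent_of_arrows A B F U I \<sigma>"
  unfolding descent_of_arrows_def
proof (intro allI impI, elim conjE)
  fix D x \<rho> y \<kappa>
  assume D: "descent_datum A B F I \<sigma> D" and \<rho>: "restricts_to A B F U I \<sigma> x \<rho> D"
    and \<kappa>: "restricts_to A B F U I \<sigma> y \<kappa> D"
  note loc = descent_datum_localD[OF D] and ov = descent_datum_overlapD[OF D]
  define \<alpha> where "\<alpha> i = Id A (local_obj D i)" for i
  have "descent_morphism A B F I \<sigma> D D \<alpha>"
    unfolding descent_morphism_def
  proof (intro conjI ballI)
    fix i assume i: "i \<in> I"
    show "\<alpha> i \<in> Hom A (local_obj D i) (local_obj D i)" "amap F (\<alpha> i) = Id B (Dom B (\<sigma> i))"
      using A.Id_in_Hom amap_Id loc[OF i] by (simp_all add: \<alpha>_def)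
    fix j assume j: "j \<in> I"
    have o: "overlap_obj A D i j \<in> Obj A" using A.Hom_Obj[OF ov(2)[OF i j]] by blast
    show "\<exists>\<beta> \<in> Hom A (overlap_obj A D i j) (overlap_obj A D i j).
        amap F \<beta> = Id B (omap F (overlap_obj A D i j)) \<and>
        res1 D i j \<odot>\<^bsub>A\<^esub> \<beta> = \<alpha> i \<odot>\<^bsub>A\<^esub> res1 D i j \<and>
        res2 D i j \<odot>\<^bsub>A\<^esub> \<beta> = \<alpha> j \<odot>\<^bsub>A\<^esub> res2 D i j"
      using A.Id_in_Hom[OF o] amap_Id[OF o] ov(2,4)[OF i j] A.Comp_Id A.Id_Comp
      by (intro bexI[of _ "Id A (overlap_obj A D i j)"]) (simp_all add: \<alpha>_def)
  qed
  moreover have "same_overlaps F I D D" by (simp add: same_overlaps_def)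
  ultimately have "\<exists>!h. h \<in> Hom A x y \<and> amap F h = Id B U \<and> (\<forall>i \<in> I. h \<odot>\<^bsub>A\<^esub> \<rho> i = \<kappa> i \<odot>\<^bsub>A\<^esub> \<alpha> i)"
    using mor[unfolded descent_of_morphisms_def] D \<rho> \<kappa> by blast
  moreover have "\<kappa> i \<odot>\<^bsub>A\<^esub> \<alpha> i = \<kappa> i" if "i \<in> I" for i
    using A.Comp_Id restricts_toD(4)[OF \<kappa> that] by (simp add: \<alpha>_def)
  ultimately show "\<exists>!h. h \<in> Hom A x y \<and> amap F h = Id B U \<and> (\<forall>i \<in> I. h \<odot>\<^bsub>A\<^esub> \<rho> i = \<kappa> i)"
    by simp
qed

lemma descent_of_arrows_imp_morphisms:
  assumes cart: "\<And>f. f \<in> Arr A \<Longrightarrow> cartesian A B F f" and arr: "descent_of_arrows A B F U I \<sigma>"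
  shows "descent_of_morphisms A B F U I \<sigma>"
  unfolding descent_of_morphisms_def
proof (intro allI impI, elim conjE)
  fix D D' x \<rho> x' \<rho>' \<alpha>
  assume D: "descent_datum A B F I \<sigma> D" and D': "descent_datum A B F I \<sigma> D'"
    and \<rho>: "restricts_to A B F U I \<sigma> x \<rho> D" and \<rho>': "restricts_to A B F U I \<sigma> x' \<rho>' D'"
    and \<alpha>: "descent_morphism A B F I \<sigma> D D' \<alpha>"
  note ov = descent_datum_overlapD[OF D] and ov' = descent_datum_overlapD[OF D']
    and r' = restricts_toD[OF \<rho>']
  have \<alpha>H: "\<alpha> i \<in> Hom A (local_obj D i) (local_obj D' i)" "amap F (\<alpha> i) = Id B (Dom B (\<sigma> i))"
    if "i \<in> I" for i using \<alpha> that by (auto simp: descent_morphism_def)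
  have "restricts_to A B F U I \<sigma> x' (\<lambda>i. \<rho>' i \<odot>\<^bsub>A\<^esub> \<alpha> i) D"
    unfolding restricts_to_def
  proof (intro conjI ballI)
    show "x' \<in> Obj A" "omap F x' = U" using r' by auto
    fix i assume i: "i \<in> I"
    show H: "\<rho>' i \<odot>\<^bsub>A\<^esub> \<alpha> i \<in> Hom A (local_obj D i) x'" using A.Comp_in_Hom \<alpha>H r' i by blast
    then show "cartesian A B F (\<rho>' i \<odot>\<^bsub>A\<^esub> \<alpha> i)" using cart by (simp add: Hom_iff)
    show "amap F (\<rho>' i \<odot>\<^bsub>A\<^esub> \<alpha> i) = \<sigma> i"
      using amap_Comp[OF \<alpha>H(1) r'(4)] \<alpha>H r'(5) B.Comp_Id[OF B.Arr_Hom] amap_in_Hom[OF r'(4)] i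
      by (metis Hom_iff)
    fix j assume j: "j \<in> I"
    obtain \<beta> where \<beta>: "\<beta> \<in> Hom A (overlap_obj A D i j) (overlap_obj A D' i j)"
      "res1 D' i j \<odot>\<^bsub>A\<^esub> \<beta> = \<alpha> i \<odot>\<^bsub>A\<^esub> res1 D i j" "res2 D' i j \<odot>\<^bsub>A\<^esub> \<beta> = \<alpha> j \<odot>\<^bsub>A\<^esub> res2 D i j"
      using \<alpha> i j unfolding descent_morphism_def by blast
    have "(\<rho>' i \<odot>\<^bsub>A\<^esub> \<alpha> i) \<odot>\<^bsub>A\<^esub> res1 D i j = (\<rho>' i \<odot>\<^bsub>A\<^esub> res1 D' i j) \<odot>\<^bsub>A\<^esub> \<beta>"
      using A.Comp_assoc[OF ov(2)[OF i j] \<alpha>H(1)[OF i] r'(4)[OF i]]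
        A.Comp_assoc[OF \<beta>(1) ov'(2)[OF i j] r'(4)[OF i]] \<beta>(2) by simp
    also have "\<dots> = (\<rho>' j \<odot>\<^bsub>A\<^esub> res2 D' i j) \<odot>\<^bsub>A\<^esub> \<beta>" using r'(6)[OF i j] by simp
    also have "\<dots> = (\<rho>' j \<odot>\<^bsub>A\<^esub> \<alpha> j) \<odot>\<^bsub>A\<^esub> res2 D i j"
      using A.Comp_assoc[OF ov(4)[OF i j] \<alpha>H(1)[OF j] r'(4)[OF j]]
        A.Comp_assoc[OF \<beta>(1) ov'(4)[OF i j] r'(4)[OF j]] \<beta>(3) by simp
    finally show "(\<rho>' i \<odot>\<^bsub>A\<^esub> \<alpha> i) \<odot>\<^bsub>A\<^esub> res1 D i j = (\<rho>' j \<odot>\<^bsub>A\<^esub> \<alpha> j) \<odot>\<^bsub>A\<^esub> res2 D i j" .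
  qed
  from descent_of_arrowsD[OF arr D \<rho> this]
  show "\<exists>!h. h \<in> Hom A x x' \<and> amap F h = Id B U \<and> (\<forall>i \<in> I. h \<odot>\<^bsub>A\<^esub> \<rho> i = \<rho>' i \<odot>\<^bsub>A\<^esub> \<alpha> i)" .
qed

end

lemma stack_iff:
  "stack E B cov P \<longleftrightarrow> fibered_in_groupoids E B P \<and>
     (\<forall>U I \<sigma>. cov U I \<sigma> \<longrightarrow> descent_of_objects E B P U I \<sigma> \<and> descent_of_arrows E B P U I \<sigma>)"
proof (cases "fibered_in_groupoids E B P")
  case True
  then have cart: "\<And>f. f \<in> Arr E \<Longrightarrow> cartesian E B P f" and fib: "fibration E B P"
    by (simp_all add: fibered_in_groupoids_iff)
  interpret fibration E B P by (fact fib)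
  show ?thesis
    using True fib cart descent_of_morphisms_imp_arrows descent_of_arrows_imp_morphisms
    unfolding stack_def general_stack_def fibered_iff_fibration by blast
qed (simp add: stack_def)

section \<open>The site of objects with free log structure\<close>

text \<open>
  The arrows \<open>U\<^sub>j\<^sub>k \<rightarrow> U\<^sub>j\<close>, for fixed \<open>j\<close> and varying \<open>k\<close>, form a covering of \<open>U\<^sub>j\<close>, and therefore
  have fibre products with \<open>U\<^sub>i\<^sub>j \<rightarrow> U\<^sub>j\<close>.
\<close>

lemma (in grothendieck_topology) triple_overlap_exists:
  assumes cov: "cov U I \<sigma>" and ijk: "i \<in> I" "j \<in> I" "k \<in> I"
    and pb: "\<And>i j. \<lbrakk>i \<in> I; j \<in> I\<rbrakk> \<Longrightarrow> is_pullback C (\<sigma> i) (\<sigma> j) (p i j) (q i j)"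
  shows "\<exists>a b. is_pullback C (q i j) (p j k) a b"
proof -
  have \<sigma>: "\<sigma> i \<in> Hom C (Dom C (\<sigma> i)) U" if "i \<in> I" for i
    using cov_Arr[OF cov that] by (simp add: Hom_iff)
  have "cov (Dom C (\<sigma> j)) I (p j)"
    using cov_pullback[OF cov \<sigma>[OF ijk(2)] pb[OF ijk(2)]] .
  then show ?thesis
    using pullback_exists pullbackD(2)[OF pb[OF ijk(1,2)] \<sigma>[OF ijk(1)] \<sigma>[OF ijk(2)]] ijk(3) by blast
qed

locale log_structures =
  fixes C :: "('o, 'a) category"
    and cov :: "('i, 'o, 'a) coverings"
    and FL CL :: "('e, 'f) category"
    and P :: "('e, 'f, 'o, 'a) functor_maps"
  assumes S1: "S1 C FL CL P" and S4: "S4 C cov FL CL P"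
begin

sublocale CL: fibration CL C P
  using S1 by (simp add: S1_def fibered_iff_fibration)

sublocale FL: fibration FL C P
  using S1 by (simp add: S1_def full_subfibration_def fibered_iff_fibration)

sublocale T: grothendieck_topology C cov
  using S4 by (simp add: S4_def)

abbreviation FLcov :: "('i, 'e, 'f) coverings" where
  "FLcov \<equiv> pullback_topology FL C P cov"

lemma FL_full: "full_subcategory FL CL"
  using S1 by (simp add: S1_def full_subfibration_def)

lemma FL_Obj: "x \<in> Obj FL \<Longrightarrow> x \<in> Obj CL"
  using FL_full by (auto simp: full_subcategory_def)

lemma FL_simps [simp]: "Dom FL = Dom CL" "Cod FL = Cod CL" "Id FL = Id CL" "Comp FL = Comp CL"
proof -
  have "FL = CL\<lparr>Obj := Obj FL, Arr := {f \<in> Arr CL. Dom CL f \<in> Obj FL \<and> Cod CL f \<in> Obj FL}\<rparr>"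
    using FL_full by (simp add: full_subcategory_def)
  from arg_cong[OF this, of Dom] arg_cong[OF this, of Cod] arg_cong[OF this, of Id]
    arg_cong[OF this, of Comp]
  show "Dom FL = Dom CL" "Cod FL = Cod CL" "Id FL = Id CL" "Comp FL = Comp CL" by simp_all
qed

lemma FL_Hom: "f \<in> Hom FL x y \<longleftrightarrow> x \<in> Obj FL \<and> y \<in> Obj FL \<and> f \<in> Hom CL x y"
proof -
  have "FL = CL\<lparr>Obj := Obj FL, Arr := {f \<in> Arr CL. Dom CL f \<in> Obj FL \<and> Cod CL f \<in> Obj FL}\<rparr>"
    using FL_full by (simp add: full_subcategory_def)
  from arg_cong[OF this, of Arr] show ?thesis by (auto simp: Hom_iff)
qed

lemma cartesian_FL:
  assumes c: "cartesian CL C P f" and f: "f \<in> Hom FL x y"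
  shows "cartesian FL C P f"
proof (rule FL.cartesianI[OF f])
  have f': "f \<in> Hom CL x y" using f FL_Hom by blast
  {
    fix z g h assume "g \<in> Hom FL z y" "h \<in> Hom C (omap P z) (omap P x)" "amap P f \<odot>\<^bsub>C\<^esub> h = amap P g"
    then show "\<exists>k\<in>Hom FL z x. amap P k = h \<and> f \<odot>\<^bsub>FL\<^esub> k = g"
      using CL.cartesian_lift[OF c f'] f FL_Hom unfolding FL_simps by metis
  next
    fix z k k' assume "k \<in> Hom FL z x" "k' \<in> Hom FL z x" "amap P k = amap P k'" "f \<odot>\<^bsub>FL\<^esub> k = f \<odot>\<^bsub>FL\<^esub> k'"
    then show "k = k'" using CL.cartesian_eq[OF c f'] FL_Hom by (metis FL_simps(4))
  }
qed

lemma FLcovD: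
  assumes "FLcov u I \<sigma>"
  shows "u \<in> Obj FL" and "cov (omap P u) I (\<lambda>i. amap P (\<sigma> i))"
    and "i \<in> I \<Longrightarrow> cartesian FL C P (\<sigma> i)" and "i \<in> I \<Longrightarrow> \<sigma> i \<in> Hom FL (Dom CL (\<sigma> i)) u"
    and "i \<in> I \<Longrightarrow> Dom CL (\<sigma> i) \<in> Obj FL"
    and "i \<in> I \<Longrightarrow> Dom C (amap P (\<sigma> i)) = omap P (Dom CL (\<sigma> i))"
proof -
  show u: "u \<in> Obj FL" "cov (omap P u) I (\<lambda>i. amap P (\<sigma> i))"
    using assms by (simp_all add: pullback_topology_def)
  assume i: "i \<in> I"
  then show c: "cartesian FL C P (\<sigma> i)" and H: "\<sigma> i \<in> Hom FL (Dom CL (\<sigma> i)) u"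
    using assms FL.cartesianD[of "\<sigma> i"] by (auto simp: pullback_topology_def)
  then show "Dom CL (\<sigma> i) \<in> Obj FL" using FL.A.Hom_Obj by blast
  show "Dom C (amap P (\<sigma> i)) = omap P (Dom CL (\<sigma> i))" using FL.amap_in_Hom[OF H] by (simp add: Hom_iff)
qed

lemma sections_sheaf:
  "y \<in> Obj CL \<Longrightarrow> sheaf FL FLcov (\<lambda>u. Hom CL u y) (\<lambda>f s. s \<odot>\<^bsub>CL\<^esub> f)"
  using S4 by (simp add: S4_def)

lemma sections_ex1:
  assumes y: "y \<in> Obj CL" and \<sigma>: "FLcov u I \<sigma>" and "\<And>i. i \<in> I \<Longrightarrow> s i \<in> Hom CL (Dom CL (\<sigma> i)) y"
    and "\<And>i j p q. \<lbrakk>i \<in> I; j \<in> I; is_pullback FL (\<sigma> i) (\<sigma> j) p q\<rbrakk> \<Longrightarrow> s i \<odot>\<^bsub>CL\<^esub> p = s j \<odot>\<^bsub>CL\<^esub> q"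
  shows "\<exists>!t. t \<in> Hom CL u y \<and> (\<forall>i \<in> I. t \<odot>\<^bsub>CL\<^esub> \<sigma> i = s i)"
  using sections_sheaf[OF y] assms(2-) unfolding sheaf_def FL_simps by blast

lemma sections_eq:
  assumes \<sigma>: "FLcov u I \<sigma>" and t: "t \<in> Hom CL u y" "t' \<in> Hom CL u y"
    and e: "\<And>i. i \<in> I \<Longrightarrow> t \<odot>\<^bsub>CL\<^esub> \<sigma> i = t' \<odot>\<^bsub>CL\<^esub> \<sigma> i"
  shows "t = t'"
proof -
  have y: "y \<in> Obj CL" using CL.A.Hom_Obj t by blast
  have H: "\<sigma> i \<in> Hom CL (Dom CL (\<sigma> i)) u" if "i \<in> I" for i using FLcovD(4)[OF \<sigma> that] FL_Hom by blast
  have "\<exists>!k. k \<in> Hom CL u y \<and> (\<forall>i \<in> I. k \<odot>\<^bsub>CL\<^esub> \<sigma> i = t' \<odot>\<^bsub>CL\<^esub> \<sigma> i)"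
  proof (rule sections_ex1[OF y \<sigma>])
    fix i assume "i \<in> I" then show "t' \<odot>\<^bsub>CL\<^esub> \<sigma> i \<in> Hom CL (Dom CL (\<sigma> i)) y"
      using CL.A.Comp_in_Hom[OF H t(2)] by blast
  next
    fix i j p q assume i: "i \<in> I" and j: "j \<in> I" and pb: "is_pullback FL (\<sigma> i) (\<sigma> j) p q"
    note pq = FL.A.pullbackD[OF pb FLcovD(4)[OF \<sigma> i] FLcovD(4)[OF \<sigma> j]]
    have "p \<in> Hom CL (Dom CL p) (Dom CL (\<sigma> i))" "q \<in> Hom CL (Dom CL p) (Dom CL (\<sigma> j))"
      using pq FL_Hom by auto
    then show "(t' \<odot>\<^bsub>CL\<^esub> \<sigma> i) \<odot>\<^bsub>CL\<^esub> p = (t' \<odot>\<^bsub>CL\<^esub> \<sigma> j) \<odot>\<^bsub>CL\<^esub> q"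
      using CL.A.Comp_assoc H i j t(2) pq(3) unfolding FL_simps by metis
  qed
  then show ?thesis using t e by blast
qed

lemma FL_descent_of_arrows: "cov U I \<sigma> \<Longrightarrow> descent_of_arrows FL C P U I \<sigma>"
  by (rule FL.descent_of_morphisms_imp_arrows) (use S4 in \<open>auto simp: S4_def general_stack_def\<close>)

lemma FL_descent_of_objects: "cov U I \<sigma> \<Longrightarrow> descent_of_objects FL C P U I \<sigma>"
  using S4 by (auto simp: S4_def general_stack_def)

text \<open>
  The sheaf condition compares arrows of \<open>CL\<close>, and gives no direct control over arrows of \<open>C\<close>,
  where coverings are not epimorphic by definition. To show \<open>s = id\<close> anyway, let \<open>m : u' \<rightarrow> u\<close> be
  a cartesian arrow over \<open>s\<close>. As \<open>s\<close> fixes the covering, each \<open>\<sigma>\<^sub>i\<close> factors through \<open>m\<close> by an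
  arrow \<open>n\<^sub>i\<close> over the same arrow of \<open>C\<close>, so \<open>u'\<close> restricts to the same datum as \<open>u\<close>. As \<open>FL\<close> is
  a stack, there is \<open>h : u \<rightarrow> u'\<close> over the identity with \<open>h \<sigma>\<^sub>i = n\<^sub>i\<close>. Then \<open>m h \<sigma>\<^sub>i = \<sigma>\<^sub>i\<close>, so
  \<open>m h = id\<close> by the sheaf condition, and the image of \<open>m h\<close> in \<open>C\<close> is \<open>s\<close>.
\<close>

lemma endomorphism_trivial:
  assumes \<sigma>: "FLcov u I \<sigma>"
    and D: "descent_datum FL C P I (\<lambda>i. amap P (\<sigma> i)) D"
    and r: "restricts_to FL C P (omap P u) I (\<lambda>i. amap P (\<sigma> i)) u \<sigma> D"
    and s: "s \<in> Hom C (omap P u) (omap P u)"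
    and fix_\<sigma>: "\<And>i. i \<in> I \<Longrightarrow> s \<odot>\<^bsub>C\<^esub> amap P (\<sigma> i) = amap P (\<sigma> i)"
  shows "s = Id C (omap P u)"
proof -
  note cov = FLcovD[OF \<sigma>] and r' = restricts_toD[OF r] and ov = descent_datum_overlapD[OF D]
  obtain u' m where m: "m \<in> Hom FL u' u" "cartesian FL C P m" "amap P m = s" "omap P u' = omap P u"
    using FL.lift_exists[OF cov(1) s] by blast
  have "\<exists>k \<in> Hom FL (local_obj D i) u'. amap P k = amap P (\<sigma> i) \<and> m \<odot>\<^bsub>FL\<^esub> k = \<sigma> i" if "i \<in> I" for i
    using FL.cartesian_lift[OF m(2,1) r'(4)[OF that]] FL.amap_in_Hom[OF r'(4)[OF that]] m fix_\<sigma>[OF that]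
    by metis
  then obtain n where n: "\<And>i. i \<in> I \<Longrightarrow> n i \<in> Hom FL (local_obj D i) u'"
    "\<And>i. i \<in> I \<Longrightarrow> amap P (n i) = amap P (\<sigma> i)" "\<And>i. i \<in> I \<Longrightarrow> m \<odot>\<^bsub>FL\<^esub> n i = \<sigma> i"
    by metis
  have "restricts_to FL C P (omap P u) I (\<lambda>i. amap P (\<sigma> i)) u' n D"
    unfolding restricts_to_def
  proof (intro conjI ballI)
    show "u' \<in> Obj FL" "omap P u' = omap P u" using m FL.A.Hom_Obj by auto
    fix i assume i: "i \<in> I"
    show "cartesian FL C P (n i)" using FL.cartesian_cancel[OF n(1) m(2,1)] n(3) cov(3) i by metis
    show "n i \<in> Hom FL (local_obj D i) u'" "amap P (n i) = amap P (\<sigma> i)" using n i by blast+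
    fix j assume j: "j \<in> I"
    show "n i \<odot>\<^bsub>FL\<^esub> res1 D i j = n j \<odot>\<^bsub>FL\<^esub> res2 D i j"
    proof (rule FL.cartesian_eq[OF m(2,1)])
      show "n i \<odot>\<^bsub>FL\<^esub> res1 D i j \<in> Hom FL (overlap_obj FL D i j) u'"
        "n j \<odot>\<^bsub>FL\<^esub> res2 D i j \<in> Hom FL (overlap_obj FL D i j) u'"
        using FL.A.Comp_in_Hom ov(2,4)[OF i j] n(1) i j by blast+
      show "amap P (n i \<odot>\<^bsub>FL\<^esub> res1 D i j) = amap P (n j \<odot>\<^bsub>FL\<^esub> res2 D i j)"
        using FL.amap_Comp[OF ov(2)[OF i j] n(1)[OF i]] FL.amap_Comp[OF ov(4)[OF i j] n(1)[OF j]]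
          FL.amap_Comp[OF ov(2)[OF i j] r'(4)[OF i]] FL.amap_Comp[OF ov(4)[OF i j] r'(4)[OF j]]
          n(2) r'(6) i j by metis
      show "m \<odot>\<^bsub>FL\<^esub> (n i \<odot>\<^bsub>FL\<^esub> res1 D i j) = m \<odot>\<^bsub>FL\<^esub> (n j \<odot>\<^bsub>FL\<^esub> res2 D i j)"
        using FL.A.Comp_assoc[OF ov(2)[OF i j] n(1)[OF i] m(1)]
          FL.A.Comp_assoc[OF ov(4)[OF i j] n(1)[OF j] m(1)] n(3) r'(6) i j by metis
    qed
  qed
  from descent_of_arrowsD[OF FL_descent_of_arrows[OF cov(2)] D r this]
  obtain h where h: "h \<in> Hom FL u u'" "amap P h = Id C (omap P u)" "\<And>i. i \<in> I \<Longrightarrow> h \<odot>\<^bsub>FL\<^esub> \<sigma> i = n i"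
    by blast
  have mh: "m \<odot>\<^bsub>FL\<^esub> h \<in> Hom FL u u" using FL.A.Comp_in_Hom h m by blast
  have "m \<odot>\<^bsub>CL\<^esub> h = Id CL u"
  proof (rule sections_eq[OF \<sigma>])
    show "m \<odot>\<^bsub>CL\<^esub> h \<in> Hom CL u u" using mh FL_Hom by simp
    show "Id CL u \<in> Hom CL u u" using CL.A.Id_in_Hom FL_Obj cov(1) by blast
    fix i assume i: "i \<in> I"
    show "(m \<odot>\<^bsub>CL\<^esub> h) \<odot>\<^bsub>CL\<^esub> \<sigma> i = Id CL u \<odot>\<^bsub>CL\<^esub> \<sigma> i"
      using FL.A.Comp_assoc[OF r'(4)[OF i] h(1) m(1)] h(3)[OF i] n(3)[OF i]
        FL.A.Id_Comp[OF r'(4)[OF i]] by simp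
  qed
  then have "amap P (Id FL u) = s \<odot>\<^bsub>C\<^esub> Id C (omap P u)" using FL.amap_Comp[OF h(1) m(1)] h(2) m(3) by simp
  then show ?thesis using FL.amap_Id[OF cov(1)] CL.B.Comp_Id[OF s] by simp
qed

text \<open>
  In a datum over a covering of \<open>FL\<close> the fibre products are formed in \<open>FL\<close>, whereas data over
  \<open>C\<close> need fibre products in \<open>C\<close>. Coverings of \<open>C\<close> do have fibre products, so \<open>pullback_image\<close>
  applies; this lemma does so for the double overlaps, and the next one for the triple overlaps.
\<close>

lemma overlaps_image:
  assumes \<pi>: "cat_functor E FL \<pi>" and \<sigma>: "FLcov u I \<sigma>" and D: "descent_datum E FL \<pi> I \<sigma> D"
    and i: "i \<in> I" and j: "j \<in> I"
  shows "is_pullback C (amap P (\<sigma> i)) (amap P (\<sigma> j))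
      (amap P (amap \<pi> (res1 D i j))) (amap P (amap \<pi> (res2 D i j)))"
    and "cartesian FL C P (amap \<pi> (res1 D i j))" and "cartesian FL C P (amap \<pi> (res2 D i j))"
proof -
  interpret \<pi>: cat_functor E FL \<pi> by fact
  note cov = FLcovD[OF \<sigma>] and pb = descent_datum_overlapD(5)[OF D i j]
  let ?p = "amap \<pi> (res1 D i j)" and ?q = "amap \<pi> (res2 D i j)"
  note pq = FL.A.pullbackD[OF pb cov(4)[OF i] cov(4)[OF j]]
  have "\<exists>p q. is_pullback C (amap P (\<sigma> i)) (amap P (\<sigma> j)) p q"
    using T.pullback_exists[OF cov(2) _ j] FL.amap_in_Hom[OF cov(4)[OF i]] by blast
  note im = FL.pullback_image[OF pb cov(4)[OF i] cov(3,4)[OF j] this]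
  show "is_pullback C (amap P (\<sigma> i)) (amap P (\<sigma> j)) (amap P ?p) (amap P ?q)" "cartesian FL C P ?p"
    by (fact im)+
  show "cartesian FL C P ?q"
    using FL.cartesian_cancel[OF pq(2) cov(3,4)[OF j]]
      FL.cartesian_Comp[OF im(2) pq(1) cov(3,4)[OF i]] pq(3) by metis
qed

lemma triple_overlaps_image:
  assumes \<pi>: "cat_functor E FL \<pi>" and \<sigma>: "FLcov u I \<sigma>" and D: "descent_datum E FL \<pi> I \<sigma> D"
    and ijk: "i \<in> I" "j \<in> I" "k \<in> I"
    and pb: "is_pullback FL (amap \<pi> (res2 D i j)) (amap \<pi> (res1 D j k)) a b"
  shows "is_pullback C (amap P (amap \<pi> (res2 D i j))) (amap P (amap \<pi> (res1 D j k)))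
      (amap P a) (amap P b)"
    and "cartesian FL C P a" and "cartesian FL C P b"
proof -
  interpret \<pi>: cat_functor E FL \<pi> by fact
  note im = overlaps_image[OF \<pi> \<sigma> D]
  have H: "amap \<pi> (res2 D i j) \<in> Hom FL (omap \<pi> (overlap_obj E D i j)) (omap \<pi> (local_obj D j))"
    "amap \<pi> (res1 D j k) \<in> Hom FL (omap \<pi> (overlap_obj E D j k)) (omap \<pi> (local_obj D j))"
    using \<pi>.amap_in_Hom descent_datum_overlapD(2,4)[OF D] ijk by blast+
  have ex: "\<exists>a b. is_pullback C (amap P (amap \<pi> (res2 D i j))) (amap P (amap \<pi> (res1 D j k))) a b"
    using T.triple_overlap_exists[OF FLcovD(2)[OF \<sigma>] ijk im(1)] .
  show "is_pullback C (amap P (amap \<pi> (res2 D i j))) (amap P (amap \<pi> (res1 D j k))) (amap P a) (amap P b)"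
    and c: "cartesian FL C P a"
    using FL.pullback_image[OF pb H(1) im(2)[OF ijk(2,3)] H(2) ex] .
  note ab = FL.A.pullbackD[OF pb H]
  show "cartesian FL C P b"
    using FL.cartesian_cancel[OF ab(2) im(2)[OF ijk(2,3)] H(2)]
      FL.cartesian_Comp[OF c ab(1) im(3)[OF ijk(1,2)] H(1)] ab(3) by simp
qed

text \<open>
  This provides the datum that \<open>endomorphism_trivial\<close> asks for.
\<close>

lemma projected_datum:
  assumes \<pi>: "cat_functor E FL \<pi>" and \<sigma>: "FLcov u I \<sigma>" and D: "descent_datum E FL \<pi> I \<sigma> D"
  shows "descent_datum FL C P I (\<lambda>i. amap P (\<sigma> i)) (descent_image \<pi> D)"
proof (rule descent_datum_image[OF \<pi> FL.cat_functor_axioms D])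
  fix i j assume "i \<in> I" "j \<in> I"
  then show "cartesian FL C P (amap \<pi> (res1 D i j)) \<and> cartesian FL C P (amap \<pi> (res2 D i j)) \<and>
        is_pullback C (amap P (\<sigma> i)) (amap P (\<sigma> j)) (amap P (amap \<pi> (res1 D i j))) (amap P (amap \<pi> (res2 D i j)))"
    using overlaps_image[OF \<pi> \<sigma> D] by blast
qed (use descent_datum_localD[OF D] FLcovD[OF \<sigma>] triple_overlaps_image[OF \<pi> \<sigma> D] in simp_all)

end

lemma ex1_eqI: "\<lbrakk>\<exists>!x. Q x; Q a; Q b\<rbrakk> \<Longrightarrow> a = b"
  by blast

text \<open>
  Families are functions on the whole index type, and coverings that come from lifts are known
  only on \<open>I\<close>. Stability under pullback along the identity makes the other values irrelevant.
\<close>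

lemma (in grothendieck_topology) cov_cong:
  assumes cov: "cov U I \<sigma>" and eq: "\<And>i. i \<in> I \<Longrightarrow> \<tau> i = \<sigma> i"
  shows "cov U I \<tau>"
proof (rule cov_pullback[OF cov Id_in_Hom[OF cov_Obj[OF cov]], where q = "\<lambda>i. Id C (Dom C (\<sigma> i))"])
  fix i assume i: "i \<in> I"
  have H: "\<sigma> i \<in> Hom C (Dom C (\<sigma> i)) U" using cov_Arr[OF cov i] by (simp add: Hom_iff)
  have "is_pullback C (Id C U) (\<sigma> i) (\<sigma> i) (Id C (Dom C (\<sigma> i)))"
  proof (rule pullbackI[OF Id_in_Hom[OF cov_Obj[OF cov]] H H])
    show "Id C (Dom C (\<sigma> i)) \<in> Hom C (Dom C (\<sigma> i)) (Dom C (\<sigma> i))"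
      using Id_in_Hom Hom_Obj[OF H] by blast
    show "Id C U \<odot> \<sigma> i = \<sigma> i \<odot> Id C (Dom C (\<sigma> i))" using Id_Comp Comp_Id H by simp
  qed (use Id_Comp in metis)+
  then show "is_pullback C (Id C U) (\<sigma> i) (\<tau> i) (Id C (Dom C (\<sigma> i)))" using eq[OF i] by simp
qed

section \<open>The fibration \<open>\<Phi>\<close> over \<open>FL\<close>\<close>

locale log_cfg = log_structures C cov FL CL P
  for C :: "('o, 'a) category"
    and cov :: "('i, 'o, 'a) coverings"
    and FL CL :: "('e, 'f) category"
    and P :: "('e, 'f, 'o, 'a) functor_maps" +
  fixes X :: "('x, 'y) category"
    and F :: "('x, 'y, 'o, 'a) functor_maps"
    and M :: "('x, 'y, 'e, 'f) functor_maps"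
  assumes LogCFG: "LogCFG C CL P X F M"
begin

sublocale X: fibration X C F
  using LogCFG by (simp add: LogCFG_def fibered_in_groupoids_iff)

lemma X_cartesian: "a \<in> Hom X x y \<Longrightarrow> cartesian X C F a"
  using LogCFG by (simp add: LogCFG_def fibered_in_groupoids_iff Hom_iff)

lemma M_Hom_cart: "a \<in> Hom X x y \<Longrightarrow> amap M a \<in> Hom (cart_part CL C P) (omap M x) (omap M y)"
  using LogCFG cat_functor.amap_in_Hom by (auto simp: LogCFG_def)

lemma M_cartesian: "a \<in> Hom X x y \<Longrightarrow> cartesian CL C P (amap M a)"
  using M_Hom_cart by (fastforce simp: Hom_iff cart_part_def)

sublocale M: cat_functor X CL M
proof -
  interpret M: cat_functor X "cart_part CL C P" M using LogCFG by (simp add: LogCFG_def)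
  show "cat_functor X CL M"
  proof
    fix x assume x: "x \<in> Obj X"
    show "omap M x \<in> Obj CL" "amap M (Id X x) = Id CL (omap M x)"
      using M.omap_in_Obj[OF x] M.amap_Id[OF x] by (simp_all add: cart_part_def)
  next
    fix f x y assume f: "f \<in> Hom X x y"
    then show "amap M f \<in> Hom CL (omap M x) (omap M y)"
      using M.amap_in_Hom[OF f] by (auto simp: Hom_iff cart_part_def cartesian_def)
    fix g z assume "g \<in> Hom X y z"
    then show "amap M (g \<odot>\<^bsub>X\<^esub> f) = amap M g \<odot>\<^bsub>CL\<^esub> amap M f"
      using M.amap_Comp[OF f] by (simp add: cart_part_def)
  qed
qed

lemma P_M_obj [simp]: "x \<in> Obj X \<Longrightarrow> omap P (omap M x) = omap F x"
  using LogCFG by (simp add: LogCFG_def)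

lemma P_M_arr: "a \<in> Hom X x y \<Longrightarrow> amap P (amap M a) = amap F a"
  using LogCFG by (simp add: LogCFG_def Hom_iff)

abbreviation \<Phi> :: "(('x, 'f) Phi_obj, ('x, 'y, 'f) Phi_arr) category" where
  "\<Phi> \<equiv> Phi C FL CL P X M"

abbreviation \<pi> :: "(('x, 'f) Phi_obj, ('x, 'y, 'f) Phi_arr, 'e, 'f) functor_maps" where
  "\<pi> \<equiv> Phi_proj CL"

text \<open>
  The forgetful functor \<open>(x, f) \<mapsto> x\<close>, which lies over \<open>FL \<rightarrow> C\<close>.
\<close>

definition \<omega> :: "(('x, 'f) Phi_obj, ('x, 'y, 'f) Phi_arr, 'x, 'y) functor_maps" where
  "\<omega> = \<lparr>omap = fst, amap = (\<lambda>(s, t, (a, b)). a)\<rparr>"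

lemma proj_simps [simp]:
  "omap \<pi> s = Dom CL (snd s)" "amap \<pi> (s, t, (a, b)) = b"
  "omap \<omega> s = fst s" "amap \<omega> (s, t, (a, b)) = a"
  by (simp_all add: Phi_proj_def \<omega>_def split_beta)

lemma Phi_ObjD:
  assumes "s \<in> Obj \<Phi>"
  shows "fst s \<in> Obj X" and "Dom CL (snd s) \<in> Obj FL" and "snd s \<in> Hom CL (Dom CL (snd s)) (omap M (fst s))"
    and "amap P (snd s) = Id C (omap F (fst s))" and "omap P (Dom CL (snd s)) = omap F (fst s)"
proof -
  show 1: "fst s \<in> Obj X" "Dom CL (snd s) \<in> Obj FL" "snd s \<in> Hom CL (Dom CL (snd s)) (omap M (fst s))"
    using assms by (auto simp: Phi_def Phi_Obj_def)
  show 2: "amap P (snd s) = Id C (omap F (fst s))"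
    using assms by (auto simp: Phi_def Phi_Obj_def)
  show "omap P (Dom CL (snd s)) = omap F (fst s)"
    using CL.amap_in_Hom[OF 1(3)] 1(1) 2 CL.B.Id_in_Hom[OF X.omap_in_Obj[OF 1(1)]] by (simp add: Hom_iff)
qed

lemma Phi_ObjI:
  assumes "x \<in> Obj X" and "u \<in> Obj FL" and "f \<in> Hom CL u (omap M x)" and "amap P f = Id C (omap F x)"
  shows "(x, f) \<in> Obj \<Phi>"
  using assms by (auto simp: Phi_def Phi_Obj_def Hom_iff)

lemma Phi_Hom_iff:
  "\<phi> \<in> Hom \<Phi> s t \<longleftrightarrow> (\<exists>a b. \<phi> = (s, t, (a, b)) \<and> s \<in> Obj \<Phi> \<and> t \<in> Obj \<Phi> \<and>
     a \<in> Hom X (fst s) (fst t) \<and> b \<in> Hom FL (Dom CL (snd s)) (Dom CL (snd t)) \<and>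
     snd t \<odot>\<^bsub>CL\<^esub> b = amap M a \<odot>\<^bsub>CL\<^esub> snd s)"
  by (cases \<phi>; cases s; cases t) (auto simp: Hom_iff Phi_def)

lemma Phi_HomI:
  assumes "s \<in> Obj \<Phi>" and "t \<in> Obj \<Phi>" and "a \<in> Hom X (fst s) (fst t)"
    and "b \<in> Hom CL (Dom CL (snd s)) (Dom CL (snd t))"
    and "snd t \<odot>\<^bsub>CL\<^esub> b = amap M a \<odot>\<^bsub>CL\<^esub> snd s"
  shows "(s, t, (a, b)) \<in> Hom \<Phi> s t"
  using assms Phi_ObjD(2)[OF assms(1)] Phi_ObjD(2)[OF assms(2)] by (simp add: Phi_Hom_iff FL_Hom)

lemma Phi_HomD:
  assumes "\<phi> \<in> Hom \<Phi> s t"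
  shows "\<phi> = (s, t, (amap \<omega> \<phi>, amap \<pi> \<phi>))" and "s \<in> Obj \<Phi>" and "t \<in> Obj \<Phi>"
    and "amap \<omega> \<phi> \<in> Hom X (fst s) (fst t)"
    and "amap \<pi> \<phi> \<in> Hom FL (Dom CL (snd s)) (Dom CL (snd t))"
    and "amap \<pi> \<phi> \<in> Hom CL (Dom CL (snd s)) (Dom CL (snd t))"
    and "snd t \<odot>\<^bsub>CL\<^esub> amap \<pi> \<phi> = amap M (amap \<omega> \<phi>) \<odot>\<^bsub>CL\<^esub> snd s"
    and "amap P (amap \<pi> \<phi>) = amap F (amap \<omega> \<phi>)"
proof -
  obtain a b where ab: "\<phi> = (s, t, (a, b))" "s \<in> Obj \<Phi>" "t \<in> Obj \<Phi>" "a \<in> Hom X (fst s) (fst t)"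
    "b \<in> Hom FL (Dom CL (snd s)) (Dom CL (snd t))" "snd t \<odot>\<^bsub>CL\<^esub> b = amap M a \<odot>\<^bsub>CL\<^esub> snd s"
    using assms by (auto simp: Phi_Hom_iff)
  have b: "b \<in> Hom CL (Dom CL (snd s)) (Dom CL (snd t))" using ab(5) FL_Hom by blast
  note s = Phi_ObjD[OF ab(2)] and t = Phi_ObjD[OF ab(3)]
  show "\<phi> = (s, t, (amap \<omega> \<phi>, amap \<pi> \<phi>))" "s \<in> Obj \<Phi>" "t \<in> Obj \<Phi>"
    "amap \<omega> \<phi> \<in> Hom X (fst s) (fst t)"
    "amap \<pi> \<phi> \<in> Hom FL (Dom CL (snd s)) (Dom CL (snd t))"
    "amap \<pi> \<phi> \<in> Hom CL (Dom CL (snd s)) (Dom CL (snd t))"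
    "snd t \<odot>\<^bsub>CL\<^esub> amap \<pi> \<phi> = amap M (amap \<omega> \<phi>) \<odot>\<^bsub>CL\<^esub> snd s"
    using ab b by simp_all
  have "amap P (snd t) \<odot>\<^bsub>C\<^esub> amap P b = amap P (amap M a) \<odot>\<^bsub>C\<^esub> amap P (snd s)"
    using CL.amap_Comp[OF b t(3)] CL.amap_Comp[OF s(3) M.amap_in_Hom[OF ab(4)]] ab(6) by simp
  then have "amap P b = amap F a"
    using CL.B.Id_Comp[OF CL.amap_in_Hom[OF b]] CL.B.Comp_Id[OF X.amap_in_Hom[OF ab(4)]] s(4) t(4,5)
      P_M_arr[OF ab(4)] by simp
  then show "amap P (amap \<pi> \<phi>) = amap F (amap \<omega> \<phi>)" using ab by simp
qed

lemma Phi_simps: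
  "Dom \<Phi> \<phi> = fst \<phi>" "Cod \<Phi> \<phi> = fst (snd \<phi>)"
  "Id \<Phi> s = (s, s, (Id X (fst s), Id CL (Dom CL (snd s))))"
  "\<psi> \<odot>\<^bsub>\<Phi>\<^esub> \<phi> = (fst \<phi>, fst (snd \<psi>), (amap \<omega> \<psi> \<odot>\<^bsub>X\<^esub> amap \<omega> \<phi>, amap \<pi> \<psi> \<odot>\<^bsub>CL\<^esub> amap \<pi> \<phi>))"
  by (auto simp: Phi_def Phi_proj_def \<omega>_def split: prod.splits)

lemma Phi_eqI:
  assumes "\<phi> \<in> Hom \<Phi> s t" and "\<psi> \<in> Hom \<Phi> s t"
    and "amap \<omega> \<phi> = amap \<omega> \<psi>" and "amap \<pi> \<phi> = amap \<pi> \<psi>"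
  shows "\<phi> = \<psi>"
  using Phi_HomD(1)[OF assms(1)] Phi_HomD(1)[OF assms(2)] assms(3,4) by metis

lemma Phi_Id: "s \<in> Obj \<Phi> \<Longrightarrow> Id \<Phi> s \<in> Hom \<Phi> s s"
  unfolding Phi_simps
  by (rule Phi_HomI) (simp_all add: Phi_ObjD X.A.Id_in_Hom CL.A.Id_in_Hom FL_Obj M.amap_Id
      CL.A.Comp_Id[OF Phi_ObjD(3)] CL.A.Id_Comp[OF Phi_ObjD(3)])

lemma Phi_Comp_eq:
  assumes "\<phi> \<in> Hom \<Phi> r s" and "\<psi> \<in> Hom \<Phi> s t"
  shows "\<psi> \<odot>\<^bsub>\<Phi>\<^esub> \<phi> = (r, t, (amap \<omega> \<psi> \<odot>\<^bsub>X\<^esub> amap \<omega> \<phi>, amap \<pi> \<psi> \<odot>\<^bsub>CL\<^esub> amap \<pi> \<phi>))"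
proof -
  have "fst \<phi> = r" "fst (snd \<psi>) = t"
    using Phi_HomD(1)[OF assms(1)] Phi_HomD(1)[OF assms(2)] by (metis fst_conv snd_conv)+
  then show ?thesis by (simp add: Phi_simps)
qed

lemma Phi_Comp:
  assumes \<phi>: "\<phi> \<in> Hom \<Phi> r s" and \<psi>: "\<psi> \<in> Hom \<Phi> s t"
  shows "\<psi> \<odot>\<^bsub>\<Phi>\<^esub> \<phi> \<in> Hom \<Phi> r t"
  unfolding Phi_Comp_eq[OF assms]
proof (rule Phi_HomI)
  note p = Phi_HomD[OF \<phi>] and q = Phi_HomD[OF \<psi>]
  note r = Phi_ObjD[OF p(2)] and s = Phi_ObjD[OF p(3)] and t = Phi_ObjD[OF q(3)]
  show "r \<in> Obj \<Phi>" "t \<in> Obj \<Phi>" using p q by auto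
  show "amap \<omega> \<psi> \<odot>\<^bsub>X\<^esub> amap \<omega> \<phi> \<in> Hom X (fst r) (fst t)"
    "amap \<pi> \<psi> \<odot>\<^bsub>CL\<^esub> amap \<pi> \<phi> \<in> Hom CL (Dom CL (snd r)) (Dom CL (snd t))"
    using X.A.Comp_in_Hom CL.A.Comp_in_Hom p q by blast+
  have "snd t \<odot>\<^bsub>CL\<^esub> (amap \<pi> \<psi> \<odot>\<^bsub>CL\<^esub> amap \<pi> \<phi>) = (snd t \<odot>\<^bsub>CL\<^esub> amap \<pi> \<psi>) \<odot>\<^bsub>CL\<^esub> amap \<pi> \<phi>"
    using CL.A.Comp_assoc[OF p(6) q(6) t(3)] by simp
  also have "\<dots> = amap M (amap \<omega> \<psi>) \<odot>\<^bsub>CL\<^esub> (snd s \<odot>\<^bsub>CL\<^esub> amap \<pi> \<phi>)"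
    using CL.A.Comp_assoc[OF p(6) s(3) M.amap_in_Hom[OF q(4)]] q(7) by simp
  also have "\<dots> = amap M (amap \<omega> \<psi> \<odot>\<^bsub>X\<^esub> amap \<omega> \<phi>) \<odot>\<^bsub>CL\<^esub> snd r"
    using CL.A.Comp_assoc[OF r(3) M.amap_in_Hom[OF p(4)] M.amap_in_Hom[OF q(4)]] p(7)
      M.amap_Comp[OF p(4) q(4)] by simp
  finally show "snd t \<odot>\<^bsub>CL\<^esub> (amap \<pi> \<psi> \<odot>\<^bsub>CL\<^esub> amap \<pi> \<phi>) =
    amap M (amap \<omega> \<psi> \<odot>\<^bsub>X\<^esub> amap \<omega> \<phi>) \<odot>\<^bsub>CL\<^esub> snd r" .
qed

lemma Phi_Comp_proj:
  assumes "\<phi> \<in> Hom \<Phi> r s" and "\<psi> \<in> Hom \<Phi> s t"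
  shows "amap \<omega> (\<psi> \<odot>\<^bsub>\<Phi>\<^esub> \<phi>) = amap \<omega> \<psi> \<odot>\<^bsub>X\<^esub> amap \<omega> \<phi>"
    and "amap \<pi> (\<psi> \<odot>\<^bsub>\<Phi>\<^esub> \<phi>) = amap \<pi> \<psi> \<odot>\<^bsub>CL\<^esub> amap \<pi> \<phi>"
  using Phi_Comp_eq[OF assms] by simp_all

lemma Phi_category: "category \<Phi>"
proof
  fix \<phi> assume "\<phi> \<in> Arr \<Phi>"
  then have "\<phi> \<in> Hom \<Phi> (Dom \<Phi> \<phi>) (Cod \<Phi> \<phi>)" by (simp add: Hom_iff)
  then show "Dom \<Phi> \<phi> \<in> Obj \<Phi>" "Cod \<Phi> \<phi> \<in> Obj \<Phi>" using Phi_HomD by blast+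
next
  fix \<phi> s t assume p: "\<phi> \<in> Hom \<Phi> s t"
  note d = Phi_HomD[OF p]
  show "\<phi> \<odot>\<^bsub>\<Phi>\<^esub> Id \<Phi> s = \<phi>"
    by (rule Phi_eqI[OF Phi_Comp[OF Phi_Id[OF d(2)] p] p])
      (simp_all add: Phi_Comp_proj[OF Phi_Id[OF d(2)] p] Phi_simps X.A.Comp_Id[OF d(4)] CL.A.Comp_Id[OF d(6)])
  show "Id \<Phi> t \<odot>\<^bsub>\<Phi>\<^esub> \<phi> = \<phi>"
    by (rule Phi_eqI[OF Phi_Comp[OF p Phi_Id[OF d(3)]] p])
      (simp_all add: Phi_Comp_proj[OF p Phi_Id[OF d(3)]] Phi_simps X.A.Id_Comp[OF d(4)] CL.A.Id_Comp[OF d(6)])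
next
  fix \<phi> \<psi> \<chi> q r s t assume h: "\<phi> \<in> Hom \<Phi> q r" "\<psi> \<in> Hom \<Phi> r s" "\<chi> \<in> Hom \<Phi> s t"
  note c = Phi_Comp[OF h(1,2)] Phi_Comp[OF h(2,3)]
  note d = Phi_HomD[OF h(1)] and e = Phi_HomD[OF h(2)] and f = Phi_HomD[OF h(3)]
  show "(\<chi> \<odot>\<^bsub>\<Phi>\<^esub> \<psi>) \<odot>\<^bsub>\<Phi>\<^esub> \<phi> = \<chi> \<odot>\<^bsub>\<Phi>\<^esub> (\<psi> \<odot>\<^bsub>\<Phi>\<^esub> \<phi>)"
    by (rule Phi_eqI[OF Phi_Comp[OF h(1) c(2)] Phi_Comp[OF c(1) h(3)]])
      (simp_all add: Phi_Comp_proj[OF h(1) c(2)] Phi_Comp_proj[OF c(1) h(3)] Phi_Comp_proj[OF h(1,2)]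
        Phi_Comp_proj[OF h(2,3)] X.A.Comp_assoc[OF d(4) e(4) f(4)] CL.A.Comp_assoc[OF d(6) e(6) f(6)])
qed (fact Phi_Id Phi_Comp)+

sublocale \<omega>: cat_functor \<Phi> X \<omega>
  using Phi_category X.A.category_axioms
  by (auto simp: cat_functor_def cat_functor_axioms_def Phi_ObjD Phi_HomD Phi_Comp_proj Phi_simps)

sublocale \<pi>: cat_functor \<Phi> FL \<pi>
  using Phi_category FL.A.category_axioms
  by (auto simp: cat_functor_def cat_functor_axioms_def Phi_ObjD Phi_HomD Phi_Comp_proj Phi_simps)

text \<open>
  The two components of the factorization are built one after the other: the arrow \<open>c\<close> of \<open>X\<close> is
  dictated by the image of the given \<open>k\<close> in \<open>C\<close>, and \<open>(c, k)\<close> is compatible with the arrows into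
  the image of \<open>M\<close> because \<open>M\<close> takes values in cartesian arrows.
\<close>

lemma Phi_cartesian:
  assumes \<phi>: "\<phi> \<in> Hom \<Phi> s t"
  shows "cartesian \<Phi> FL \<pi> \<phi>"
proof (rule \<pi>.cartesianI[OF \<phi>])
  note p = Phi_HomD[OF \<phi>] and a_cart = X_cartesian[OF Phi_HomD(4)[OF \<phi>]]
  note s = Phi_ObjD[OF p(2)] and t = Phi_ObjD[OF p(3)]
  {
    fix r \<psi> k assume \<psi>: "\<psi> \<in> Hom \<Phi> r t" and k: "k \<in> Hom FL (omap \<pi> r) (omap \<pi> s)"
      and e: "amap \<pi> \<phi> \<odot>\<^bsub>FL\<^esub> k = amap \<pi> \<psi>"
    note q = Phi_HomD[OF \<psi>]
    note r = Phi_ObjD[OF q(2)]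
    have kH: "k \<in> Hom FL (Dom CL (snd r)) (Dom CL (snd s))" "k \<in> Hom CL (Dom CL (snd r)) (Dom CL (snd s))"
      using k FL_Hom by auto
    have Pk: "amap P k \<in> Hom C (omap F (fst r)) (omap F (fst s))"
      using CL.amap_in_Hom[OF kH(2)] r s by simp
    have "amap F (amap \<omega> \<phi>) \<odot>\<^bsub>C\<^esub> amap P k = amap F (amap \<omega> \<psi>)"
      using p(8) q(8) e FL.amap_Comp[OF kH(1) p(5)] by simp
    then obtain c where c: "c \<in> Hom X (fst r) (fst s)" "amap F c = amap P k" "amap \<omega> \<phi> \<odot>\<^bsub>X\<^esub> c = amap \<omega> \<psi>"
      using X.cartesian_lift[OF a_cart p(4) q(4) Pk] by blast
    have "snd s \<odot>\<^bsub>CL\<^esub> k = amap M c \<odot>\<^bsub>CL\<^esub> snd r"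
    proof (rule CL.cartesian_eq[OF M_cartesian[OF p(4)] M.amap_in_Hom[OF p(4)]])
      note Mc = M.amap_in_Hom[OF c(1)]
      show "snd s \<odot>\<^bsub>CL\<^esub> k \<in> Hom CL (Dom CL (snd r)) (omap M (fst s))"
        "amap M c \<odot>\<^bsub>CL\<^esub> snd r \<in> Hom CL (Dom CL (snd r)) (omap M (fst s))"
        using CL.A.Comp_in_Hom kH s r Mc by blast+
      show "amap P (snd s \<odot>\<^bsub>CL\<^esub> k) = amap P (amap M c \<odot>\<^bsub>CL\<^esub> snd r)"
        using CL.amap_Comp[OF kH(2) s(3)] CL.amap_Comp[OF r(3) Mc] P_M_arr[OF c(1)] c(2) r(4) s(4)
          CL.B.Id_Comp[OF Pk] CL.B.Comp_Id[OF Pk] by simp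
      have "amap M (amap \<omega> \<phi>) \<odot>\<^bsub>CL\<^esub> (snd s \<odot>\<^bsub>CL\<^esub> k) = snd t \<odot>\<^bsub>CL\<^esub> amap \<pi> \<psi>"
        using CL.A.Comp_assoc[OF kH(2) s(3) M.amap_in_Hom[OF p(4)]] p(7)
          CL.A.Comp_assoc[OF kH(2) p(6) t(3)] e by simp
      also have "\<dots> = amap M (amap \<omega> \<phi>) \<odot>\<^bsub>CL\<^esub> (amap M c \<odot>\<^bsub>CL\<^esub> snd r)"
        using q(7) c(3) M.amap_Comp[OF c(1) p(4)] CL.A.Comp_assoc[OF r(3) Mc M.amap_in_Hom[OF p(4)]] by simp
      finally show "amap M (amap \<omega> \<phi>) \<odot>\<^bsub>CL\<^esub> (snd s \<odot>\<^bsub>CL\<^esub> k)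
        = amap M (amap \<omega> \<phi>) \<odot>\<^bsub>CL\<^esub> (amap M c \<odot>\<^bsub>CL\<^esub> snd r)" .
    qed
    then have \<chi>: "(r, s, (c, k)) \<in> Hom \<Phi> r s" using Phi_HomI q(2) p(2) c(1) kH(2) by blast
    have "\<phi> \<odot>\<^bsub>\<Phi>\<^esub> (r, s, (c, k)) = \<psi>"
      by (rule Phi_eqI[OF Phi_Comp[OF \<chi> \<phi>] \<psi>]) (use Phi_Comp_proj[OF \<chi> \<phi>] c e in simp_all)
    then show "\<exists>\<chi> \<in> Hom \<Phi> r s. amap \<pi> \<chi> = k \<and> \<phi> \<odot>\<^bsub>\<Phi>\<^esub> \<chi> = \<psi>"
      using \<chi> by (intro bexI[of _ "(r, s, (c, k))"]) simp_all
  next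
    fix r \<psi> \<chi> assume h: "\<psi> \<in> Hom \<Phi> r s" "\<chi> \<in> Hom \<Phi> r s" and e: "amap \<pi> \<psi> = amap \<pi> \<chi>"
      and "\<phi> \<odot>\<^bsub>\<Phi>\<^esub> \<psi> = \<phi> \<odot>\<^bsub>\<Phi>\<^esub> \<chi>"
    then have "amap \<omega> \<phi> \<odot>\<^bsub>X\<^esub> amap \<omega> \<psi> = amap \<omega> \<phi> \<odot>\<^bsub>X\<^esub> amap \<omega> \<chi>"
      using Phi_Comp_proj(1)[OF _ \<phi>] by metis
    moreover have "amap F (amap \<omega> \<psi>) = amap F (amap \<omega> \<chi>)"
      using Phi_HomD(8)[OF h(1)] Phi_HomD(8)[OF h(2)] e by simp
    ultimately have "amap \<omega> \<psi> = amap \<omega> \<chi>"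
      using X.cartesian_eq[OF a_cart p(4) Phi_HomD(4)[OF h(1)] Phi_HomD(4)[OF h(2)]] by blast
    then show "\<psi> = \<chi>" using Phi_eqI h e by blast
  }
qed

lemma Phi_fibered_in_groupoids: "fibered_in_groupoids \<Phi> FL \<pi>"
  unfolding fibered_in_groupoids_iff
proof
  show "\<forall>\<phi> \<in> Arr \<Phi>. cartesian \<Phi> FL \<pi> \<phi>" using Phi_cartesian by (simp add: Hom_iff)
  show "fibration \<Phi> FL \<pi>"
  proof
    fix t b u assume t': "t \<in> Obj \<Phi>" and b: "b \<in> Hom FL u (omap \<pi> t)"
    note t = Phi_ObjD[OF t']
    have bH: "b \<in> Hom CL u (Dom CL (snd t))" "u \<in> Obj FL" using b FL_Hom by auto
    have Pb: "amap P b \<in> Hom C (omap P u) (omap F (fst t))" using CL.amap_in_Hom[OF bH(1)] t by simp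
    obtain x a where a: "a \<in> Hom X x (fst t)" "amap F a = amap P b" "omap F x = omap P u"
      using X.lift_exists[OF t(1) Pb] by blast
    have x: "x \<in> Obj X" using X.A.Hom_Obj a by blast
    note tb = CL.A.Comp_in_Hom[OF bH(1) t(3)]
    have "amap P (snd t \<odot>\<^bsub>CL\<^esub> b) = amap P b"
      using CL.amap_Comp[OF bH(1) t(3)] t(4) CL.B.Id_Comp[OF Pb] by simp
    moreover have "Id C (omap F x) \<in> Hom C (omap P u) (omap P (omap M x))"
      using CL.B.Id_in_Hom[OF X.omap_in_Obj[OF x]] a(3) x by simp
    moreover have "amap P (amap M a) \<odot>\<^bsub>C\<^esub> Id C (omap F x) = amap P b"
      using P_M_arr[OF a(1)] a CL.B.Comp_Id[OF Pb] by simp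
    ultimately obtain f where f: "f \<in> Hom CL u (omap M x)" "amap P f = Id C (omap F x)"
      "amap M a \<odot>\<^bsub>CL\<^esub> f = snd t \<odot>\<^bsub>CL\<^esub> b"
      using CL.cartesian_lift[OF M_cartesian[OF a(1)] M.amap_in_Hom[OF a(1)] tb] by metis
    have s: "(x, f) \<in> Obj \<Phi>" using Phi_ObjI x bH f by blast
    have u: "Dom CL f = u" using f by (simp add: Hom_iff)
    have "((x, f), t, (a, b)) \<in> Hom \<Phi> (x, f) t" using Phi_HomI[OF s t', of a b] a bH f u by simp
    then show "\<exists>s. \<exists>\<phi> \<in> Hom \<Phi> s t. cartesian \<Phi> FL \<pi> \<phi> \<and> amap \<pi> \<phi> = b \<and> omap \<pi> s = u"
      using Phi_cartesian u by (intro exI[of _ "(x, f)"] bexI[of _ "((x, f), t, (a, b))"]) simp_all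
  qed
qed

section \<open>Descent for \<open>\<Phi>\<close> from descent for \<open>X\<close>\<close>

lemma underlying_datum:
  assumes \<sigma>: "FLcov u I \<sigma>" and D: "descent_datum \<Phi> FL \<pi> I \<sigma> D"
  shows "descent_datum X C F I (\<lambda>i. amap P (\<sigma> i)) (descent_image \<omega> D)"
proof (rule descent_datum_image[OF \<omega>.cat_functor_axioms X.cat_functor_axioms D])
  note loc = descent_datum_localD[OF D] and ov = descent_datum_overlapD[OF D]
    and im = overlaps_image[OF \<pi>.cat_functor_axioms \<sigma> D]
    and im3 = triple_overlaps_image[OF \<pi>.cat_functor_axioms \<sigma> D]
  fix i assume i: "i \<in> I"
  show "omap F (omap \<omega> (local_obj D i)) = Dom C (amap P (\<sigma> i))"
    using loc(2)[OF i] Phi_ObjD(5)[OF loc(1)[OF i]] FLcovD(6)[OF \<sigma> i] by simp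
  fix j assume j: "j \<in> I"
  note r = Phi_HomD[OF ov(2)[OF i j]] Phi_HomD[OF ov(4)[OF i j]]
  show "cartesian X C F (amap \<omega> (res1 D i j)) \<and> cartesian X C F (amap \<omega> (res2 D i j)) \<and>
      is_pullback C (amap P (\<sigma> i)) (amap P (\<sigma> j)) (amap F (amap \<omega> (res1 D i j)))
        (amap F (amap \<omega> (res2 D i j)))"
    using X_cartesian[OF r(4)] X_cartesian[OF r(12)] im(1)[OF i j] r(8,16) by simp
  fix k z a b assume k: "k \<in> I" and a: "a \<in> Hom \<Phi> z (overlap_obj \<Phi> D i j)"
    and b: "b \<in> Hom \<Phi> z (overlap_obj \<Phi> D j k)"
    and pb: "is_pullback FL (amap \<pi> (res2 D i j)) (amap \<pi> (res1 D j k)) (amap \<pi> a) (amap \<pi> b)"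
  show "cartesian X C F (amap \<omega> a) \<and> cartesian X C F (amap \<omega> b) \<and>
      is_pullback C (amap F (amap \<omega> (res2 D i j))) (amap F (amap \<omega> (res1 D j k)))
        (amap F (amap \<omega> a)) (amap F (amap \<omega> b))"
    using X_cartesian[OF Phi_HomD(4)[OF a]] X_cartesian[OF Phi_HomD(4)[OF b]] im3(1)[OF i j k pb]
      r(16) Phi_HomD(8)[OF ov(2)[OF j k]] Phi_HomD(8)[OF a] Phi_HomD(8)[OF b] by simp
qed

lemma underlying_restricts_to:
  assumes \<sigma>: "FLcov u I \<sigma>" and D: "descent_datum \<Phi> FL \<pi> I \<sigma> D"
    and r: "restricts_to \<Phi> FL \<pi> u I \<sigma> s \<rho> D"
  shows "restricts_to X C F (omap P u) I (\<lambda>i. amap P (\<sigma> i)) (fst s) (\<lambda>i. amap \<omega> (\<rho> i)) (descent_image \<omega> D)"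
proof -
  note r' = restricts_toD[OF r]
  have "restricts_to X C F (omap P u) I (\<lambda>i. amap P (\<sigma> i)) (omap \<omega> s) (\<lambda>i. amap \<omega> (\<rho> i)) (descent_image \<omega> D)"
  proof (rule restricts_to_image[OF \<omega>.cat_functor_axioms D r])
    show "omap F (omap \<omega> s) = omap P u" using Phi_ObjD(5)[OF r'(1)] r'(2) by simp
    fix i assume "i \<in> I"
    note \<rho> = Phi_HomD[OF r'(4)[OF this]] and e = r'(5)[OF this]
    show "cartesian X C F (amap \<omega> (\<rho> i)) \<and> amap F (amap \<omega> (\<rho> i)) = amap P (\<sigma> i)"
      using X_cartesian[OF \<rho>(4)] \<rho>(8) e by simp
  qed
  then show ?thesis by simp
qed

text \<open>
  The component in \<open>FL\<close> has to be an identity, so the component \<open>h\<close> in \<open>X\<close> given by descent is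
  the only candidate. That it respects the arrows into the image of \<open>M\<close> is an equality of
  sections of a sheaf, which holds on the covering.
\<close>

lemma Phi_descent_of_arrows:
  assumes \<sigma>: "FLcov u I \<sigma>" and X: "descent_of_arrows X C F (omap P u) I (\<lambda>i. amap P (\<sigma> i))"
  shows "descent_of_arrows \<Phi> FL \<pi> u I \<sigma>"
  unfolding descent_of_arrows_def
proof (intro allI impI, elim conjE)
  fix D s \<rho> t \<kappa> assume D: "descent_datum \<Phi> FL \<pi> I \<sigma> D"
    and \<rho>: "restricts_to \<Phi> FL \<pi> u I \<sigma> s \<rho> D" and \<kappa>: "restricts_to \<Phi> FL \<pi> u I \<sigma> t \<kappa> D"
  note r = restricts_toD[OF \<rho>] and k = restricts_toD[OF \<kappa>] and cov = FLcovD[OF \<sigma>]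
  note s = Phi_ObjD[OF r(1)] and t = Phi_ObjD[OF k(1)]
  have su: "Dom CL (snd s) = u" and tu: "Dom CL (snd t) = u" using r(2) k(2) by simp_all
  have ex1: "\<exists>!h. h \<in> Hom X (fst s) (fst t) \<and> amap F h = Id C (omap P u) \<and>
      (\<forall>i \<in> I. h \<odot>\<^bsub>X\<^esub> amap \<omega> (\<rho> i) = amap \<omega> (\<kappa> i))"
    using descent_of_arrowsD[OF X underlying_datum[OF \<sigma> D] underlying_restricts_to[OF \<sigma> D \<rho>]
        underlying_restricts_to[OF \<sigma> D \<kappa>]] .
  then obtain h where h: "h \<in> Hom X (fst s) (fst t)" "amap F h = Id C (omap P u)"
    "\<And>i. i \<in> I \<Longrightarrow> h \<odot>\<^bsub>X\<^esub> amap \<omega> (\<rho> i) = amap \<omega> (\<kappa> i)" by blast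
  note Mh = M.amap_in_Hom[OF h(1)]
  have "amap M h \<odot>\<^bsub>CL\<^esub> snd s = snd t"
  proof (rule sections_eq[OF \<sigma>])
    show "amap M h \<odot>\<^bsub>CL\<^esub> snd s \<in> Hom CL u (omap M (fst t))" "snd t \<in> Hom CL u (omap M (fst t))"
      using CL.A.Comp_in_Hom[OF s(3) Mh] t(3) su tu by simp_all
    fix i assume i: "i \<in> I"
    note \<rho>i = Phi_HomD[OF r(4)[OF i]] and \<kappa>i = Phi_HomD[OF k(4)[OF i]]
    note loc = Phi_ObjD[OF \<rho>i(2)]
    have "(amap M h \<odot>\<^bsub>CL\<^esub> snd s) \<odot>\<^bsub>CL\<^esub> amap \<pi> (\<rho> i)
        = amap M h \<odot>\<^bsub>CL\<^esub> (amap M (amap \<omega> (\<rho> i)) \<odot>\<^bsub>CL\<^esub> snd (local_obj D i))"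
      using CL.A.Comp_assoc[OF \<rho>i(6) s(3) Mh] \<rho>i(7) by simp
    also have "\<dots> = snd t \<odot>\<^bsub>CL\<^esub> amap \<pi> (\<kappa> i)"
      using CL.A.Comp_assoc[OF loc(3) M.amap_in_Hom[OF \<rho>i(4)] Mh] M.amap_Comp[OF \<rho>i(4) h(1)] h(3)[OF i]
        \<kappa>i(7) by simp
    finally show "(amap M h \<odot>\<^bsub>CL\<^esub> snd s) \<odot>\<^bsub>CL\<^esub> \<sigma> i = snd t \<odot>\<^bsub>CL\<^esub> \<sigma> i"
      using r(5)[OF i] k(5)[OF i] by simp
  qed
  moreover have Iu: "Id CL u \<in> Hom CL u u" using CL.A.Id_in_Hom FL_Obj cov(1) by blast
  moreover have "snd t \<odot>\<^bsub>CL\<^esub> Id CL u = snd t" using CL.A.Comp_Id t(3) tu by metis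
  ultimately have H: "(s, t, (h, Id CL u)) \<in> Hom \<Phi> s t" (is "?h \<in> _")
    using Phi_HomI[OF r(1) k(1) h(1), of "Id CL u"] su tu by simp
  show "\<exists>!h. h \<in> Hom \<Phi> s t \<and> amap \<pi> h = Id FL u \<and> (\<forall>i \<in> I. h \<odot>\<^bsub>\<Phi>\<^esub> \<rho> i = \<kappa> i)"
  proof (rule ex1I[of _ ?h], intro conjI ballI)
    show "?h \<in> Hom \<Phi> s t" by (fact H)
    show "amap \<pi> ?h = Id FL u" by simp
    fix i assume i: "i \<in> I"
    have "Id CL u \<odot>\<^bsub>CL\<^esub> \<sigma> i = \<sigma> i" using CL.A.Id_Comp cov(4)[OF i] FL_Hom by blast
    then show "?h \<odot>\<^bsub>\<Phi>\<^esub> \<rho> i = \<kappa> i"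
      using Phi_eqI[OF Phi_Comp[OF r(4)[OF i] H] k(4)[OF i]] Phi_Comp_proj[OF r(4)[OF i] H] h(3)[OF i]
        r(5)[OF i] k(5)[OF i] by simp
  next
    fix h' assume h': "h' \<in> Hom \<Phi> s t \<and> amap \<pi> h' = Id FL u \<and> (\<forall>i \<in> I. h' \<odot>\<^bsub>\<Phi>\<^esub> \<rho> i = \<kappa> i)"
    then have H': "h' \<in> Hom \<Phi> s t" by blast
    note d = Phi_HomD[OF H']
    have "amap F (amap \<omega> h') = Id C (omap P u)" using d(8) h' FL.amap_Id[OF cov(1)] by simp
    moreover have "\<forall>i \<in> I. amap \<omega> h' \<odot>\<^bsub>X\<^esub> amap \<omega> (\<rho> i) = amap \<omega> (\<kappa> i)"
      using Phi_Comp_proj(1)[OF r(4) H'] h' by metis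
    ultimately have "amap \<omega> h' = h" using ex1 d(4) h by blast
    then show "h' = ?h" using Phi_eqI[OF H' H] h' by simp
  qed
qed

text \<open>
  The underlying data descend to an object \<open>x\<close> of \<open>X\<close>, and the composites \<open>u\<^sub>i \<rightarrow> M x\<^sub>i \<rightarrow> M x\<close> glue
  to a section \<open>t : u \<rightarrow> M x\<close>. It lies over an endomorphism of the base of \<open>u\<close> that fixes the
  covering, hence over the identity by \<open>endomorphism_trivial\<close>, and so \<open>(x, t)\<close> is an object of
  \<open>\<Phi>\<close>.
\<close>

lemma Phi_descent_of_objects:
  assumes \<sigma>: "FLcov u I \<sigma>" and X: "descent_of_objects X C F (omap P u) I (\<lambda>i. amap P (\<sigma> i))"
  shows "descent_of_objects \<Phi> FL \<pi> u I \<sigma>"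
  unfolding descent_of_objects_def
proof (intro allI impI)
  fix D assume D: "descent_datum \<Phi> FL \<pi> I \<sigma> D"
  note loc = descent_datum_localD[OF D] and ov = descent_datum_overlapD[OF D] and cov = FLcovD[OF \<sigma>]
  obtain x \<rho> where "restricts_to X C F (omap P u) I (\<lambda>i. amap P (\<sigma> i)) x \<rho> (descent_image \<omega> D)"
    using X underlying_datum[OF \<sigma> D] unfolding descent_of_objects_def by blast
  note r = restricts_toD[OF this, simplified]
  let ?f = "\<lambda>i. snd (local_obj D i)"
  note f = Phi_ObjD[OF loc(1)]
  have dom: "Dom CL (?f i) = Dom CL (\<sigma> i)" if "i \<in> I" for i using loc(2)[OF that] by simp
  have \<sigma>H: "\<sigma> i \<in> Hom CL (Dom CL (?f i)) u" if "i \<in> I" for i using cov(4)[OF that] FL_Hom dom[OF that] by simp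
  define S where "S i = amap M (\<rho> i) \<odot>\<^bsub>CL\<^esub> ?f i" for i
  have M\<rho>: "amap M (\<rho> i) \<in> Hom CL (omap M (fst (local_obj D i))) (omap M x)" if "i \<in> I" for i
    using M.amap_in_Hom[OF r(4)[OF that]] .
  have S: "S i \<in> Hom CL (Dom CL (?f i)) (omap M x)" if "i \<in> I" for i
    unfolding S_def using CL.A.Comp_in_Hom f(3) M\<rho> that by blast
  have S_overlap: "S i \<odot>\<^bsub>CL\<^esub> amap \<pi> (res1 D i j) = S j \<odot>\<^bsub>CL\<^esub> amap \<pi> (res2 D i j)"
    if ij: "i \<in> I" "j \<in> I" for i j
  proof -
    note d1 = Phi_HomD[OF ov(2)[OF ij]] and d2 = Phi_HomD[OF ov(4)[OF ij]]
    note o = Phi_ObjD(3)[OF d1(2)]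
    have "S i \<odot>\<^bsub>CL\<^esub> amap \<pi> (res1 D i j)
        = amap M (\<rho> i) \<odot>\<^bsub>CL\<^esub> (amap M (amap \<omega> (res1 D i j)) \<odot>\<^bsub>CL\<^esub> snd (overlap_obj \<Phi> D i j))"
      unfolding S_def using CL.A.Comp_assoc[OF d1(6) f(3)[OF ij(1)] M\<rho>[OF ij(1)]] d1(7) by simp
    also have "\<dots> = amap M (\<rho> i \<odot>\<^bsub>X\<^esub> amap \<omega> (res1 D i j)) \<odot>\<^bsub>CL\<^esub> snd (overlap_obj \<Phi> D i j)"
      using CL.A.Comp_assoc[OF o M.amap_in_Hom[OF d1(4)] M\<rho>[OF ij(1)]] M.amap_Comp[OF d1(4) r(4)[OF ij(1)]] by simp
    also have "\<dots> = amap M (\<rho> j \<odot>\<^bsub>X\<^esub> amap \<omega> (res2 D i j)) \<odot>\<^bsub>CL\<^esub> snd (overlap_obj \<Phi> D i j)"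
      using r(6)[OF ij] by simp
    also have "\<dots> = amap M (\<rho> j) \<odot>\<^bsub>CL\<^esub> (amap M (amap \<omega> (res2 D i j)) \<odot>\<^bsub>CL\<^esub> snd (overlap_obj \<Phi> D i j))"
      using CL.A.Comp_assoc[OF o M.amap_in_Hom[OF d2(4)] M\<rho>[OF ij(2)]] M.amap_Comp[OF d2(4) r(4)[OF ij(2)]] by simp
    also have "\<dots> = S j \<odot>\<^bsub>CL\<^esub> amap \<pi> (res2 D i j)"
      unfolding S_def using CL.A.Comp_assoc[OF d2(6) f(3)[OF ij(2)] M\<rho>[OF ij(2)]] d2(7) by simp
    finally show ?thesis .
  qed
  have "\<exists>!t. t \<in> Hom CL u (omap M x) \<and> (\<forall>i \<in> I. t \<odot>\<^bsub>CL\<^esub> \<sigma> i = S i)"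
  proof (rule sections_ex1[OF M.omap_in_Obj[OF r(1)] \<sigma>])
    fix i assume i: "i \<in> I"
    show "S i \<in> Hom CL (Dom CL (\<sigma> i)) (omap M x)" using S[OF i] dom[OF i] by simp
    fix j p q assume j: "j \<in> I" and pb: "is_pullback FL (\<sigma> i) (\<sigma> j) p q"
    note \<sigma>i = cov(4)[OF i] and \<sigma>j = cov(4)[OF j]
    note d1 = Phi_HomD[OF ov(2)[OF i j]] and d2 = Phi_HomD[OF ov(4)[OF i j]]
    \<comment> \<open>Every fibre product factors through the one chosen in the datum, where the sections agree.\<close>
    obtain k where k: "k \<in> Hom FL (Dom FL p) (Dom FL (amap \<pi> (res1 D i j)))"
      "amap \<pi> (res1 D i j) \<odot>\<^bsub>FL\<^esub> k = p" "amap \<pi> (res2 D i j) \<odot>\<^bsub>FL\<^esub> k = q"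
      using FL.A.pullback_factor[OF ov(5)[OF i j] \<sigma>i \<sigma>j FL.A.pullbackD[OF pb \<sigma>i \<sigma>j]] .
    have kH: "k \<in> Hom CL (Dom CL p) (Dom CL (snd (overlap_obj \<Phi> D i j)))"
      using k(1) d1(6) FL_Hom by (simp add: Hom_iff)
    show "S i \<odot>\<^bsub>CL\<^esub> p = S j \<odot>\<^bsub>CL\<^esub> q"
      using CL.A.Comp_assoc[OF kH d1(6) S[OF i]] CL.A.Comp_assoc[OF kH d2(6) S[OF j]] S_overlap[OF i j] k
      by simp
  qed
  then obtain t where t: "t \<in> Hom CL u (omap M x)" "\<And>i. i \<in> I \<Longrightarrow> t \<odot>\<^bsub>CL\<^esub> \<sigma> i = S i" by blast
  have "amap P t = Id C (omap P u)"
  proof (rule endomorphism_trivial[OF \<sigma> projected_datum[OF \<pi>.cat_functor_axioms \<sigma> D]])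
    have "\<sigma> i \<odot>\<^bsub>CL\<^esub> amap \<pi> (res1 D i j) = \<sigma> j \<odot>\<^bsub>CL\<^esub> amap \<pi> (res2 D i j)" if "i \<in> I" "j \<in> I" for i j
      using FL.A.pullbackD(3)[OF ov(5)[OF that] cov(4)[OF that(1)] cov(4)[OF that(2)]] by simp
    then show "restricts_to FL C P (omap P u) I (\<lambda>i. amap P (\<sigma> i)) u \<sigma> (descent_image \<pi> D)"
      using cov dom unfolding restricts_to_def by simp
    show "amap P t \<in> Hom C (omap P u) (omap P u)" using CL.amap_in_Hom[OF t(1)] r(1,2) by simp
    fix i assume i: "i \<in> I"
    have "amap P t \<odot>\<^bsub>C\<^esub> amap P (\<sigma> i) = amap P (amap M (\<rho> i)) \<odot>\<^bsub>C\<^esub> amap P (?f i)"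
      using CL.amap_Comp[OF \<sigma>H[OF i] t(1)] t(2)[OF i] CL.amap_Comp[OF f(3)[OF i] M\<rho>[OF i]] S_def by simp
    also have "\<dots> = amap P (\<sigma> i)"
      using P_M_arr[OF r(4)[OF i]] f(4)[OF i] CL.B.Comp_Id[OF X.amap_in_Hom[OF r(4)[OF i]]] r(5)[OF i] by simp
    finally show "amap P t \<odot>\<^bsub>C\<^esub> amap P (\<sigma> i) = amap P (\<sigma> i)" .
  qed
  then have y: "(x, t) \<in> Obj \<Phi>" using Phi_ObjI[OF r(1) cov(1) t(1)] r(2) by simp
  have tu: "Dom CL t = u" using t(1) by (simp add: Hom_iff)
  define R where "R i = (local_obj D i, (x, t), (\<rho> i, \<sigma> i))" for i
  have R: "R i \<in> Hom \<Phi> (local_obj D i) (x, t)" if "i \<in> I" for i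
    unfolding R_def using Phi_HomI[OF loc(1)[OF that] y, of "\<rho> i" "\<sigma> i"] r(4)[OF that] \<sigma>H[OF that] tu
      t(2)[OF that] by (simp add: S_def)
  have "restricts_to \<Phi> FL \<pi> u I \<sigma> (x, t) R D"
    unfolding restricts_to_def
  proof (intro conjI ballI)
    show "(x, t) \<in> Obj \<Phi>" "omap \<pi> (x, t) = u" using y tu by simp_all
    fix i assume i: "i \<in> I"
    show "R i \<in> Hom \<Phi> (local_obj D i) (x, t)" "cartesian \<Phi> FL \<pi> (R i)" using R[OF i] Phi_cartesian by blast+
    show "amap \<pi> (R i) = \<sigma> i" by (simp add: R_def)
    fix j assume j: "j \<in> I"
    show "R i \<odot>\<^bsub>\<Phi>\<^esub> res1 D i j = R j \<odot>\<^bsub>\<Phi>\<^esub> res2 D i j"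
      using Phi_eqI[OF Phi_Comp[OF ov(2)[OF i j] R[OF i]] Phi_Comp[OF ov(4)[OF i j] R[OF j]]]
        Phi_Comp_proj[OF ov(2)[OF i j] R[OF i]] Phi_Comp_proj[OF ov(4)[OF i j] R[OF j]] r(6)[OF i j]
        FL.A.pullbackD(3)[OF ov(5)[OF i j] cov(4)[OF i] cov(4)[OF j]]
      by (simp add: R_def)
  qed
  then show "\<exists>y R. restricts_to \<Phi> FL \<pi> u I \<sigma> y R D" by blast
qed

lemma stack_Phi: "stack X C cov F \<Longrightarrow> stack \<Phi> FL FLcov \<pi>"
  using Phi_fibered_in_groupoids Phi_descent_of_objects Phi_descent_of_arrows FLcovD(2)
  unfolding stack_iff by blast

end

section \<open>Descent for \<open>X\<close> from descent for \<open>\<Phi>\<close>\<close>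

locale flog_cfg = log_cfg C cov FL CL P X F M
  for C :: "('o, 'a) category"
    and cov :: "('i, 'o, 'a) coverings"
    and FL CL :: "('e, 'f) category"
    and P :: "('e, 'f, 'o, 'a) functor_maps"
    and X :: "('x, 'y) category"
    and F :: "('x, 'y, 'o, 'a) functor_maps"
    and M :: "('x, 'y, 'e, 'f) functor_maps" +
  assumes FLogCFG: "FLogCFG C FL CL P X F M"
begin

lemma M_FL_Obj: "x \<in> Obj X \<Longrightarrow> omap M x \<in> Obj FL"
  using FLogCFG cat_functor.omap_in_Obj by (fastforce simp: FLogCFG_def cart_part_def)

lemma M_FL_Hom: "a \<in> Hom X x y \<Longrightarrow> amap M a \<in> Hom FL (omap M x) (omap M y)"
  using M_FL_Obj X.A.Hom_Obj M.amap_in_Hom FL_Hom by blast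

lemma M_FL_cartesian: "a \<in> Hom X x y \<Longrightarrow> cartesian FL C P (amap M a)"
  using cartesian_FL M_cartesian M_FL_Hom by blast

sublocale MFL: cat_functor X FL M
  using M_FL_Obj M_FL_Hom M.amap_Id M.amap_Comp X.A.category_axioms FL.A.category_axioms
  by (simp add: cat_functor_def cat_functor_axioms_def)

text \<open>
  A section of \<open>\<omega>\<close>, available because \<open>M x\<close> lies in \<open>FL\<close>: an object \<open>x\<close> becomes the object \<open>(x,
  id)\<close> of \<open>\<Phi>\<close> over \<open>M x\<close>.
\<close>

definition \<iota> :: "('x, 'y, ('x, 'f) Phi_obj, ('x, 'y, 'f) Phi_arr) functor_maps" where
  "\<iota> = \<lparr>omap = (\<lambda>x. (x, Id CL (omap M x))),
     amap = (\<lambda>a. ((Dom X a, Id CL (omap M (Dom X a))), (Cod X a, Id CL (omap M (Cod X a))), (a, amap M a)))\<rparr>"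

lemma \<iota>_simps [simp]:
  "omap \<iota> x = (x, Id CL (omap M x))" "amap \<omega> (amap \<iota> a) = a" "amap \<pi> (amap \<iota> a) = amap M a"
  by (simp_all add: \<iota>_def)

lemma Dom_Id_M [simp]: "x \<in> Obj X \<Longrightarrow> Dom CL (Id CL (omap M x)) = omap M x"
  using CL.A.Id_in_Hom[OF M.omap_in_Obj] by (simp add: Hom_iff)

lemma \<iota>_Obj: "x \<in> Obj X \<Longrightarrow> omap \<iota> x \<in> Obj \<Phi>"
  using Phi_ObjI[of x "omap M x" "Id CL (omap M x)"] M_FL_Obj CL.A.Id_in_Hom[OF M.omap_in_Obj]
    CL.amap_Id[OF M.omap_in_Obj] by simp

lemma \<iota>_Hom:
  assumes a: "a \<in> Hom X x y"
  shows "amap \<iota> a \<in> Hom \<Phi> (omap \<iota> x) (omap \<iota> y)"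
proof -
  have o: "x \<in> Obj X" "y \<in> Obj X" using X.A.Hom_Obj[OF a] by auto
  have "(omap \<iota> x, omap \<iota> y, (a, amap M a)) \<in> Hom \<Phi> (omap \<iota> x) (omap \<iota> y)"
    using Phi_HomI[OF \<iota>_Obj[OF o(1)] \<iota>_Obj[OF o(2)], of a "amap M a"] a o M.amap_in_Hom[OF a]
      CL.A.Id_Comp[OF M.amap_in_Hom[OF a]] CL.A.Comp_Id[OF M.amap_in_Hom[OF a]] by simp
  then show ?thesis using a by (simp add: \<iota>_def Hom_iff)
qed

sublocale \<iota>: cat_functor X \<Phi> \<iota>
proof
  fix x assume x: "x \<in> Obj X"
  show "omap \<iota> x \<in> Obj \<Phi>" by (fact \<iota>_Obj[OF x])
  show "amap \<iota> (Id X x) = Id \<Phi> (omap \<iota> x)"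
    by (rule Phi_eqI[OF \<iota>_Hom[OF X.A.Id_in_Hom[OF x]] Phi_Id[OF \<iota>_Obj[OF x]]])
      (simp_all add: Phi_simps x M.amap_Id)
next
  fix a x y assume a: "a \<in> Hom X x y"
  show "amap \<iota> a \<in> Hom \<Phi> (omap \<iota> x) (omap \<iota> y)" by (fact \<iota>_Hom[OF a])
  fix b z assume b: "b \<in> Hom X y z"
  show "amap \<iota> (b \<odot>\<^bsub>X\<^esub> a) = amap \<iota> b \<odot>\<^bsub>\<Phi>\<^esub> amap \<iota> a"
    by (rule Phi_eqI[OF \<iota>_Hom[OF X.A.Comp_in_Hom[OF a b]] Phi_Comp[OF \<iota>_Hom[OF a] \<iota>_Hom[OF b]]])
      (simp_all add: Phi_Comp_proj[OF \<iota>_Hom[OF a] \<iota>_Hom[OF b]] M.amap_Comp[OF a b])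
qed

lemma M_datum:
  assumes D: "descent_datum X C F I \<sigma> D"
  shows "descent_datum FL C P I \<sigma> (descent_image M D)"
proof (rule descent_datum_image[OF MFL.cat_functor_axioms FL.cat_functor_axioms D])
  note loc = descent_datum_localD[OF D] and ov = descent_datum_overlapD[OF D]
  fix i assume i: "i \<in> I"
  show "omap P (omap M (local_obj D i)) = Dom C (\<sigma> i)" using loc[OF i] by simp
  fix j assume j: "j \<in> I"
  show "cartesian FL C P (amap M (res1 D i j)) \<and> cartesian FL C P (amap M (res2 D i j)) \<and>
      is_pullback C (\<sigma> i) (\<sigma> j) (amap P (amap M (res1 D i j))) (amap P (amap M (res2 D i j)))"
    using M_FL_cartesian ov[OF i j] P_M_arr by metis
  fix k z a b assume k: "k \<in> I" and a: "a \<in> Hom X z (overlap_obj X D i j)"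
    and b: "b \<in> Hom X z (overlap_obj X D j k)"
    and pb: "is_pullback C (amap F (res2 D i j)) (amap F (res1 D j k)) (amap F a) (amap F b)"
  show "cartesian FL C P (amap M a) \<and> cartesian FL C P (amap M b) \<and>
      is_pullback C (amap P (amap M (res2 D i j))) (amap P (amap M (res1 D j k)))
        (amap P (amap M a)) (amap P (amap M b))"
    using M_FL_cartesian[OF a] M_FL_cartesian[OF b] pb P_M_arr[OF a] P_M_arr[OF b]
      P_M_arr[OF ov(4)[OF i j]] P_M_arr[OF ov(2)[OF j k]] by simp
qed

lemma M_restricts_to:
  assumes D: "descent_datum X C F I \<sigma> D" and r: "restricts_to X C F U I \<sigma> x \<rho> D"
  shows "restricts_to FL C P U I \<sigma> (omap M x) (\<lambda>i. amap M (\<rho> i)) (descent_image M D)"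
proof (rule restricts_to_image[OF MFL.cat_functor_axioms D r])
  show "omap P (omap M x) = U" using restricts_toD(1,2)[OF r] by simp
  fix i assume "i \<in> I"
  note h = restricts_toD(4,5)[OF r this]
  show "cartesian FL C P (amap M (\<rho> i)) \<and> amap P (amap M (\<rho> i)) = \<sigma> i"
    using M_FL_cartesian[OF h(1)] P_M_arr[OF h(1)] h(2) by simp
qed

lemma restricts_to_FLcov:
  assumes cov: "cov U I \<sigma>" and r: "restricts_to FL C P U I \<sigma> y \<mu> D"
  shows "FLcov y I \<mu>"
  using restricts_toD[OF r] T.cov_cong[OF cov, of "\<lambda>i. amap P (\<mu> i)"]
  unfolding pullback_topology_def by (auto simp: Hom_iff)

text \<open>
  A datum in \<open>X\<close> over \<open>C\<close> does not by itself lie over a covering of \<open>FL\<close>. It does once its image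
  under \<open>M\<close> has been descended to some \<open>y\<close>, with the restriction arrows \<open>\<mu>\<^sub>i : M x\<^sub>i \<rightarrow> y\<close> as the
  covering.
\<close>

lemma \<iota>_datum:
  assumes D: "descent_datum X C F I \<sigma> D" and r: "restricts_to FL C P U I \<sigma> y \<mu> (descent_image M D)"
  shows "descent_datum \<Phi> FL \<pi> I \<mu> (descent_image \<iota> D)"
proof (rule descent_datum_image[OF \<iota>.cat_functor_axioms \<pi>.cat_functor_axioms D])
  note loc = descent_datum_localD[OF D] and ov = descent_datum_overlapD[OF D]
    and \<mu> = restricts_toD[OF r, simplified]
  fix i assume i: "i \<in> I"
  show "omap \<pi> (omap \<iota> (local_obj D i)) = Dom FL (\<mu> i)"
    using loc(1)[OF i] \<mu>(4)[OF i] by (simp add: Hom_iff)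
  fix j assume j: "j \<in> I"
  note r1 = ov(2)[OF i j] and r2 = ov(4)[OF i j]
  have "is_pullback FL (\<mu> i) (\<mu> j) (amap M (res1 D i j)) (amap M (res2 D i j))"
    using FL.cartesian_pullback[OF \<mu>(4)[OF i] \<mu>(3)[OF j] \<mu>(4)[OF j] M_FL_cartesian[OF r1] M_FL_Hom[OF r1]
        M_FL_Hom[OF r2]] \<mu>(5)[OF i] \<mu>(5)[OF j] \<mu>(6)[OF i j] ov(5)[OF i j] P_M_arr[OF r1] P_M_arr[OF r2]
    by simp
  then show "cartesian \<Phi> FL \<pi> (amap \<iota> (res1 D i j)) \<and> cartesian \<Phi> FL \<pi> (amap \<iota> (res2 D i j)) \<and>
      is_pullback FL (\<mu> i) (\<mu> j) (amap \<pi> (amap \<iota> (res1 D i j))) (amap \<pi> (amap \<iota> (res2 D i j)))"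
    using Phi_cartesian[OF \<iota>_Hom[OF r1]] Phi_cartesian[OF \<iota>_Hom[OF r2]] by simp
  fix k z a b assume k: "k \<in> I" and a: "a \<in> Hom X z (overlap_obj X D i j)"
    and b: "b \<in> Hom X z (overlap_obj X D j k)" and e: "res2 D i j \<odot>\<^bsub>X\<^esub> a = res1 D j k \<odot>\<^bsub>X\<^esub> b"
    and pb: "is_pullback C (amap F (res2 D i j)) (amap F (res1 D j k)) (amap F a) (amap F b)"
  note r1' = ov(2)[OF j k]
  have "amap M (res2 D i j) \<odot>\<^bsub>FL\<^esub> amap M a = amap M (res1 D j k) \<odot>\<^bsub>FL\<^esub> amap M b"
    using MFL.amap_Comp[OF a r2] MFL.amap_Comp[OF b r1'] e by simp
  then have "is_pullback FL (amap M (res2 D i j)) (amap M (res1 D j k)) (amap M a) (amap M b)"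
    using FL.cartesian_pullback[OF M_FL_Hom[OF r2] M_FL_cartesian[OF r1'] M_FL_Hom[OF r1']
        M_FL_cartesian[OF a] M_FL_Hom[OF a] M_FL_Hom[OF b]] pb P_M_arr[OF r2] P_M_arr[OF r1']
      P_M_arr[OF a] P_M_arr[OF b] by simp
  then show "cartesian \<Phi> FL \<pi> (amap \<iota> a) \<and> cartesian \<Phi> FL \<pi> (amap \<iota> b) \<and>
      is_pullback FL (amap \<pi> (amap \<iota> (res2 D i j))) (amap \<pi> (amap \<iota> (res1 D j k)))
        (amap \<pi> (amap \<iota> a)) (amap \<pi> (amap \<iota> b))"
    using Phi_cartesian[OF \<iota>_Hom[OF a]] Phi_cartesian[OF \<iota>_Hom[OF b]] by simp
qed

text \<open>
  Descending the image under \<open>M\<close> in \<open>FL\<close> gives \<open>y\<close>, and descending the objects \<open>(x\<^sub>i, id)\<close> over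
  the covering of \<open>y\<close> gives an object \<open>(x, f)\<close> of \<open>\<Phi>\<close>, whose first component is the one sought.
\<close>

lemma X_descent_of_objects:
  assumes cov: "cov U I \<sigma>" and Phi: "\<And>y \<mu>. FLcov y I \<mu> \<Longrightarrow> descent_of_objects \<Phi> FL \<pi> y I \<mu>"
  shows "descent_of_objects X C F U I \<sigma>"
  unfolding descent_of_objects_def
proof (intro allI impI)
  fix D assume D: "descent_datum X C F I \<sigma> D"
  note loc = descent_datum_localD[OF D] and ov = descent_datum_overlapD[OF D]
  obtain y \<mu> where r: "restricts_to FL C P U I \<sigma> y \<mu> (descent_image M D)"
    using FL_descent_of_objects[OF cov] M_datum[OF D] unfolding descent_of_objects_def by blast
  note \<mu> = restricts_toD[OF r]
  obtain s \<rho> where "restricts_to \<Phi> FL \<pi> y I \<mu> s \<rho> (descent_image \<iota> D)"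
    using Phi[OF restricts_to_FLcov[OF cov r]] \<iota>_datum[OF D r] unfolding descent_of_objects_def by blast
  note s = restricts_toD[OF this]
  have \<rho>: "amap \<omega> (\<rho> i) \<in> Hom X (local_obj D i) (fst s)" if "i \<in> I" for i
    using Phi_HomD(4)[OF s(4)[OF that]] by simp
  have "restricts_to X C F U I \<sigma> (fst s) (\<lambda>i. amap \<omega> (\<rho> i)) D"
    unfolding restricts_to_def
  proof (intro conjI ballI)
    show "fst s \<in> Obj X" "omap F (fst s) = U" using Phi_ObjD[OF s(1)] s(2) \<mu>(2) by simp_all
    fix i assume i: "i \<in> I"
    show "amap \<omega> (\<rho> i) \<in> Hom X (local_obj D i) (fst s)" by (fact \<rho>[OF i])
    then show "cartesian X C F (amap \<omega> (\<rho> i))" by (rule X_cartesian)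
    show "amap F (amap \<omega> (\<rho> i)) = \<sigma> i"
      using Phi_HomD(8)[OF s(4)[OF i]] s(5)[OF i] \<mu>(5)[OF i] by simp
    fix j assume j: "j \<in> I"
    have "amap \<omega> (\<rho> i \<odot>\<^bsub>\<Phi>\<^esub> amap \<iota> (res1 D i j)) = amap \<omega> (\<rho> j \<odot>\<^bsub>\<Phi>\<^esub> amap \<iota> (res2 D i j))"
      using s(6)[OF i j] by simp
    then show "amap \<omega> (\<rho> i) \<odot>\<^bsub>X\<^esub> res1 D i j = amap \<omega> (\<rho> j) \<odot>\<^bsub>X\<^esub> res2 D i j"
      using Phi_Comp_proj(1)[OF \<iota>_Hom[OF ov(2)[OF i j]] s(4)[OF i, unfolded descent_image_simps]]
        Phi_Comp_proj(1)[OF \<iota>_Hom[OF ov(4)[OF i j]] s(4)[OF j, unfolded descent_image_simps]] by simp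
  qed
  then show "\<exists>x \<rho>. restricts_to X C F U I \<sigma> x \<rho> D" by blast
qed

text \<open>
  Let \<open>x\<close> and \<open>x'\<close> restrict to the same datum. What should be the image under \<open>M\<close> of the arrow
  sought is known in advance: it is the arrow \<open>g : M x \<rightarrow> M x'\<close> obtained by descent in \<open>FL\<close>. Thus
  \<open>(x, id)\<close> and \<open>(x', g)\<close> are objects of \<open>\<Phi>\<close> over the same object \<open>M x\<close> and restrict to the same
  datum, and an arrow between them over the identity of \<open>M x\<close> is an arrow \<open>x \<rightarrow> x'\<close> with image
  \<open>g\<close>.
\<close>

lemma X_descent_of_arrows:
  assumes cov: "cov U I \<sigma>" and Phi: "\<And>y \<mu>. FLcov y I \<mu> \<Longrightarrow> descent_of_arrows \<Phi> FL \<pi> y I \<mu>"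
  shows "descent_of_arrows X C F U I \<sigma>"
  unfolding descent_of_arrows_def
proof (intro allI impI, elim conjE)
  fix D x \<rho> x' \<kappa> assume D: "descent_datum X C F I \<sigma> D"
    and \<rho>: "restricts_to X C F U I \<sigma> x \<rho> D" and \<kappa>: "restricts_to X C F U I \<sigma> x' \<kappa> D"
  note r = restricts_toD[OF \<rho>] and k = restricts_toD[OF \<kappa>]
    and loc = descent_datum_localD[OF D] and ov = descent_datum_overlapD[OF D]
  let ?\<mu> = "\<lambda>i. amap M (\<rho> i)"
  note M\<rho> = M_restricts_to[OF D \<rho>]
  note FLc = restricts_to_FLcov[OF cov M\<rho>]
  have ex1: "\<exists>!h. h \<in> Hom FL (omap M x) (omap M x') \<and> amap P h = Id C U \<and>
      (\<forall>i \<in> I. h \<odot>\<^bsub>FL\<^esub> ?\<mu> i = amap M (\<kappa> i))"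
    using descent_of_arrowsD[OF FL_descent_of_arrows[OF cov] M_datum[OF D] M\<rho> M_restricts_to[OF D \<kappa>]] .
  then obtain g where g: "g \<in> Hom FL (omap M x) (omap M x')" "amap P g = Id C U"
    "\<And>i. i \<in> I \<Longrightarrow> g \<odot>\<^bsub>FL\<^esub> ?\<mu> i = amap M (\<kappa> i)" by blast
  have gH: "g \<in> Hom CL (omap M x) (omap M x')" and gd: "Dom CL g = omap M x"
    using g(1) FL_Hom by (auto simp: Hom_iff)
  have s: "(x', g) \<in> Obj \<Phi>" using Phi_ObjI[OF k(1) M_FL_Obj[OF r(1)] gH] g(2) k(2) by simp
  define K where "K i = (omap \<iota> (local_obj D i), (x', g), (\<kappa> i, ?\<mu> i))" for i
  have K: "K i \<in> Hom \<Phi> (omap \<iota> (local_obj D i)) (x', g)" if i: "i \<in> I" for i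
    unfolding K_def
    using Phi_HomI[OF \<iota>_Obj[OF loc(1)[OF i]] s, of "\<kappa> i" "?\<mu> i"] k(4)[OF i] M.amap_in_Hom[OF r(4)[OF i]]
      gd g(3)[OF i] loc(1)[OF i] CL.A.Comp_Id[OF M.amap_in_Hom[OF k(4)[OF i]]] by simp
  have \<iota>\<rho>: "restricts_to \<Phi> FL \<pi> (omap M x) I ?\<mu> (omap \<iota> x) (\<lambda>i. amap \<iota> (\<rho> i)) (descent_image \<iota> D)"
  proof (rule restricts_to_image[OF \<iota>.cat_functor_axioms D \<rho>])
    show "omap \<pi> (omap \<iota> x) = omap M x" using r(1) by simp
    fix i assume "i \<in> I"
    then show "cartesian \<Phi> FL \<pi> (amap \<iota> (\<rho> i)) \<and> amap \<pi> (amap \<iota> (\<rho> i)) = ?\<mu> i"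
      using Phi_cartesian[OF \<iota>_Hom[OF r(4)]] by simp
  qed
  have "restricts_to \<Phi> FL \<pi> (omap M x) I ?\<mu> (x', g) K (descent_image \<iota> D)"
    unfolding restricts_to_def descent_image_simps
  proof (intro conjI ballI)
    show "(x', g) \<in> Obj \<Phi>" "omap \<pi> (x', g) = omap M x" using s gd by simp_all
    fix i assume i: "i \<in> I"
    show "K i \<in> Hom \<Phi> (omap \<iota> (local_obj D i)) (x', g)" "cartesian \<Phi> FL \<pi> (K i)"
      using K[OF i] Phi_cartesian by blast+
    show "amap \<pi> (K i) = ?\<mu> i" by (simp add: K_def)
    fix j assume j: "j \<in> I"
    note c1 = \<iota>_Hom[OF ov(2)[OF i j]] and c2 = \<iota>_Hom[OF ov(4)[OF i j]]
    have "amap M (\<rho> i) \<odot>\<^bsub>CL\<^esub> amap M (res1 D i j) = amap M (\<rho> j) \<odot>\<^bsub>CL\<^esub> amap M (res2 D i j)"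
      using restricts_toD(6)[OF M\<rho> i j] by simp
    then show "K i \<odot>\<^bsub>\<Phi>\<^esub> amap \<iota> (res1 D i j) = K j \<odot>\<^bsub>\<Phi>\<^esub> amap \<iota> (res2 D i j)"
      using Phi_eqI[OF Phi_Comp[OF c1 K[OF i]] Phi_Comp[OF c2 K[OF j]]]
        Phi_Comp_proj[OF c1 K[OF i]] Phi_Comp_proj[OF c2 K[OF j]] k(6)[OF i j] by (simp add: K_def)
  qed
  note exPhi = descent_of_arrowsD[OF Phi[OF FLc] \<iota>_datum[OF D M\<rho>] \<iota>\<rho> this]
  then obtain h where h: "h \<in> Hom \<Phi> (omap \<iota> x) (x', g)" "\<And>i. i \<in> I \<Longrightarrow> h \<odot>\<^bsub>\<Phi>\<^esub> amap \<iota> (\<rho> i) = K i"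
    "amap \<pi> h = Id FL (omap M x)" by blast
  note hd = Phi_HomD[OF h(1)]
  show "\<exists>!h. h \<in> Hom X x x' \<and> amap F h = Id C U \<and> (\<forall>i \<in> I. h \<odot>\<^bsub>X\<^esub> \<rho> i = \<kappa> i)"
  proof (rule ex1I[of _ "amap \<omega> h"], intro conjI ballI)
    show "amap \<omega> h \<in> Hom X x x'" using hd(4) by simp
    show "amap F (amap \<omega> h) = Id C U" using hd(8) h(3) FL.amap_Id[OF M_FL_Obj[OF r(1)]] r(1,2) by simp
    fix i assume i: "i \<in> I"
    have "amap \<omega> (h \<odot>\<^bsub>\<Phi>\<^esub> amap \<iota> (\<rho> i)) = \<kappa> i" using h(2)[OF i] by (simp add: K_def)
    then show "amap \<omega> h \<odot>\<^bsub>X\<^esub> \<rho> i = \<kappa> i" using Phi_Comp_proj(1)[OF \<iota>_Hom[OF r(4)[OF i]] h(1)] by simp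
  next
    fix l assume l: "l \<in> Hom X x x' \<and> amap F l = Id C U \<and> (\<forall>i \<in> I. l \<odot>\<^bsub>X\<^esub> \<rho> i = \<kappa> i)"
    then have lH: "l \<in> Hom X x x'" by blast
    have "amap M l \<odot>\<^bsub>FL\<^esub> ?\<mu> i = amap M (\<kappa> i)" if "i \<in> I" for i
      using MFL.amap_Comp[OF r(4)[OF that] lH] l that by simp
    then have "amap M l \<in> Hom FL (omap M x) (omap M x') \<and> amap P (amap M l) = Id C U \<and>
        (\<forall>i \<in> I. amap M l \<odot>\<^bsub>FL\<^esub> ?\<mu> i = amap M (\<kappa> i))"
      using M_FL_Hom[OF lH] P_M_arr[OF lH] l by simp
    moreover have "g \<in> Hom FL (omap M x) (omap M x') \<and> amap P g = Id C U \<and>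
        (\<forall>i \<in> I. g \<odot>\<^bsub>FL\<^esub> ?\<mu> i = amap M (\<kappa> i))"
      using g by blast
    ultimately have Ml: "amap M l = g" by (rule ex1_eqI[OF ex1])
    define L where "L = (omap \<iota> x, (x', g), (l, Id CL (omap M x)))"
    have IM: "Id CL (omap M x) \<in> Hom CL (omap M x) (omap M x)" using CL.A.Id_in_Hom[OF M.omap_in_Obj[OF r(1)]] .
    have L: "L \<in> Hom \<Phi> (omap \<iota> x) (x', g)"
      unfolding L_def using Phi_HomI[OF \<iota>_Obj[OF r(1)] s, of l "Id CL (omap M x)"] lH IM gd r(1) Ml by simp
    have "L \<odot>\<^bsub>\<Phi>\<^esub> amap \<iota> (\<rho> i) = K i" if i: "i \<in> I" for i
      using Phi_eqI[OF Phi_Comp[OF \<iota>_Hom[OF r(4)[OF i]] L] K[OF i]] Phi_Comp_proj[OF \<iota>_Hom[OF r(4)[OF i]] L] l i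
        CL.A.Id_Comp[OF M.amap_in_Hom[OF r(4)[OF i]]] by (simp add: K_def L_def)
    moreover have "amap \<pi> L = Id FL (omap M x)" by (simp add: L_def)
    ultimately have "L \<in> Hom \<Phi> (omap \<iota> x) (x', g) \<and> amap \<pi> L = Id FL (omap M x) \<and>
        (\<forall>i \<in> I. L \<odot>\<^bsub>\<Phi>\<^esub> amap \<iota> (\<rho> i) = K i)"
      using L by blast
    moreover have "h \<in> Hom \<Phi> (omap \<iota> x) (x', g) \<and> amap \<pi> h = Id FL (omap M x) \<and>
        (\<forall>i \<in> I. h \<odot>\<^bsub>\<Phi>\<^esub> amap \<iota> (\<rho> i) = K i)"
      using h by blast
    ultimately have "L = h" by (rule ex1_eqI[OF exPhi])
    then show "l = amap \<omega> h" by (auto simp: L_def)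
  qed
qed

lemma stack_X: "stack \<Phi> FL FLcov \<pi> \<Longrightarrow> stack X C cov F"
  using LogCFG X_descent_of_objects X_descent_of_arrows
  unfolding stack_iff LogCFG_def by blast

end

theorem proposition2p6:
  fixes C :: "('o, 'a) category"
    and cov :: "('i, 'o, 'a) coverings"
    and FL CL :: "('e, 'f) category"
    and P :: "('e, 'f, 'o, 'a) functor_maps"
    and X :: "('x, 'y) category"
    and F :: "('x, 'y, 'o, 'a) functor_maps"
    and M :: "('x, 'y, 'e, 'f) functor_maps"
  assumes "S1 C FL CL P"
    and "S4 C cov FL CL P"
    and "LogCFG C CL P X F M"
  shows "(stack X C cov F \<longrightarrow>
            stack (Phi C FL CL P X M) FL (pullback_topology FL C P cov) (Phi_proj CL)) \<and>
         (FLogCFG C FL CL P X F M \<longrightarrow>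
            (stack X C cov F \<longleftrightarrow>
             stack (Phi C FL CL P X M) FL (pullback_topology FL C P cov) (Phi_proj CL)))"
proof -
  interpret log_cfg C cov FL CL P X F M by unfold_locales (fact assms)+
  have "stack X C cov F" if "FLogCFG C FL CL P X F M" and "stack \<Phi> FL FLcov \<pi>"
  proof -
    interpret flog_cfg C cov FL CL P X F M by unfold_locales (fact that)
    show ?thesis using stack_X that by blast
  qed
  then show ?thesis using stack_Phi by blast
qed

end
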